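(* Let $k\ge 1$, $f\in C^\infty(\mathbb{R})$ and $t\in\mathbb{R}$. For all $E\subset J^k(\mathbb{R})$, $$0\le \dim_{\mathrm{Hau}} J_{f,t}(E)\le 1\quad\text{and}\quad 0\le \dim_{\mathrm{Hau}} V_{f,t}(E)\le \frac{(k+1)(k+2)}{2}.$$ Moreover, for all pairs $(\alpha,\beta)\in[0,1]\times\left[0,\frac{(k+1)(k+2)}{2}\right]$, there exists $E_{\alpha,\beta}\subset J^k(\mathbb{R})$ (depending on $f$ and $t$) satisfying $$\dim_{\mathrm{Hau}} J_{f,t}(E_{\alpha,\beta})=\alpha\quad\text{and}\quad \dim_{\mathrm{Hau}} V_{f,t}(E_{\alpha,\beta})=\beta.$$
   Context: Let $k\ge 1$ be an integer. The jet space Carnot group $J^k(\mathbb{R})$ is the set $\mathbb{R}^{k+2}$, with points written $(x,u_k,\ldots,u_0)$, equipped with the group operation $(x,u_k,\ldots,u_0)\odot(y,v_k,\ldots,v_0)=(x+y,w_k,\ldots,w_0)$, where $w_k=u_k+v_k$ and $w_s=u_s+v_s+\sum_{j=s+1}^k u_j\frac{y^{j-s}}{(j-s)!}$ for $s=0,\ldots,k-1$; inverses $p^{-1}$ are with respect to $\odot$. The horizontal bundle is framed by the left-invariant vector fields $X^{(k)}=\frac{\partial}{\partial x}+u_k\frac{\partial}{\partial u_{k-1}}+\cdots+u_1\frac{\partial}{\partial u_0}$ and $\frac{\partial}{\partial u_k}$, declared orthonormal; a horizontal curve is a curve that is absolutely continuous into $\mathbb{R}^{k+2}$ and whose derivative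 lies a.e. in the horizontal bundle. The Carnot–Carathéodory distance $d_{cc}(p,q)$ is the infimum of lengths of horizontal curves connecting $p$ to $q$. $\dim_{\mathrm{Hau}}$ of subsets of $J^k(\mathbb{R})$ is Hausdorff dimension with respect to $d_{cc}$ (with $\dim_{\mathrm{Hau}}\emptyset=0$). For $f\in C^\infty(\mathbb{R})$ and $x\in\mathbb{R}$, $j^k_x(f):=j^k(f)(x):=(x,f^{(k)}(x),f^{(k-1)}(x),\ldots,f(x))\in J^k(\mathbb{R})$, and $\mathrm{im}(j^k(f)):=\{j^k_x(f):x\in\mathbb{R}\}$. For $t\in\mathbb{R}$, $\{x=t\}:=\{(x,u_k,\ldots,u_0)\in J^k(\mathbb{R}):x=t\}$. For $f\in C^\infty(\mathbb{R})$ and $t\in\mathbb{R}$, the vertical mapping $V_{f,t}:J^k(\mathbb{R})\to\{x=t\}$ and the horizontal mapping $J_{f,t}:J^k(\mathbb{R})\to\mathrm{im}(j^k(f))$ are $V_{f,t}(x,u_k,\ldots,u_0):=(x,u_k,\ldots,u_0)\odot j^k_{x-t}(f)^{-1}$ and $J_{f,t}(x,u_k,\ldots,u_0):=j^k_{x-t}(f)$. *)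

theory Defs
  imports "HOL-Analysis.Analysis" "HOL-Algebra.Group"
begin

section \<open>Hausdorff dimension with respect to a distance function\<close>

definition diam_wrt :: "('a \<Rightarrow> 'a \<Rightarrow> ennreal) \<Rightarrow> 'a set \<Rightarrow> ennreal" where
  "diam_wrt d U = (SUP x\<in>U. SUP y\<in>U. d x y)"

(* "diam(U)^s" for a set of finite diameter, with the usual conventions that the empty set
   contributes 0 for every s and that 0^0 = 1 (whereas 0 powr 0 = 0 in the library). *)
definition diam_power :: "('a \<Rightarrow> 'a \<Rightarrow> ennreal) \<Rightarrow> real \<Rightarrow> 'a set \<Rightarrow> ennreal" where
  "diam_power d s U =
     (if U = {} then 0 else if s = 0 then 1
      else ennreal (enn2real (diam_wrt d U) powr s))"

(* Countable covers; finite ones are included by padding with empty sets. The covering sets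
   may be arbitrary, since intersecting them with E does not increase their diameters. *)
definition hausdorff_premeasure ::
    "('a \<Rightarrow> 'a \<Rightarrow> ennreal) \<Rightarrow> real \<Rightarrow> real \<Rightarrow> 'a set \<Rightarrow> ennreal" where
  "hausdorff_premeasure d s \<delta> E =
     Inf {(\<Sum>i. diam_power d s (U i)) | U :: nat \<Rightarrow> 'a set.
            E \<subseteq> (\<Union>i. U i) \<and> (\<forall>i. diam_wrt d (U i) \<le> ennreal \<delta>)}"

definition hausdorff_measure :: "('a \<Rightarrow> 'a \<Rightarrow> ennreal) \<Rightarrow> real \<Rightarrow> 'a set \<Rightarrow> ennreal" where
  "hausdorff_measure d s E = (SUP \<delta>\<in>{0<..}. hausdorff_premeasure d s \<delta> E)"

definition hausdorff_dim :: "('a \<Rightarrow> 'a \<Rightarrow> ennreal) \<Rightarrow> 'a set \<Rightarrow> ereal" where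
  "hausdorff_dim d E = Inf {ereal s | s. 0 \<le> s \<and> hausdorff_measure d s E = 0}"


section \<open>The jet space Carnot group\<close>

(* The point (x, u_k, ..., u_0) is the pair (x, u), where u i is the coordinate u_i; coordinates
   with index above k are fixed to be 0, so that the carrier is a copy of R^(k+2). *)
type_synonym jet = "real \<times> (nat \<Rightarrow> real)"

definition jet_space :: "nat \<Rightarrow> jet set" where
  "jet_space k = {p. \<forall>i>k. snd p i = 0}"

(* For s = k the sum is empty. *)
definition jet_mult :: "nat \<Rightarrow> jet \<Rightarrow> jet \<Rightarrow> jet" where
  "jet_mult k p q =
     (fst p + fst q,
      \<lambda>s. if s \<le> k
          then snd p s + snd q s + (\<Sum>j=Suc s..k. snd p j * (fst q ^ (j - s) / fact (j - s)))
          else 0)"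

definition jet_group :: "nat \<Rightarrow> jet monoid" where
  "jet_group k = \<lparr>carrier = jet_space k, mult = jet_mult k, one = (0, \<lambda>_. 0)\<rparr>"


section \<open>Horizontal curves and the Carnot-Caratheodory distance\<close>

(* Values of the frame d/dx + u_k d/du_(k-1) + ... + u_1 d/du_0 and d/du_k at a point; tangent
   vectors are written in the coordinates (x, u_k, ..., u_0), encoded like points. *)
definition frame_X :: "nat \<Rightarrow> jet \<Rightarrow> jet" where
  "frame_X k p = (1, \<lambda>i. if i < k then snd p (Suc i) else 0)"

definition frame_U :: "nat \<Rightarrow> jet \<Rightarrow> jet" where
  "frame_U k p = (0, \<lambda>i. if i = k then 1 else 0)"

definition frame_comb :: "nat \<Rightarrow> jet \<Rightarrow> real \<Rightarrow> real \<Rightarrow> jet" where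
  "frame_comb k p a b =
     (a * fst (frame_X k p) + b * fst (frame_U k p),
      \<lambda>i. a * snd (frame_X k p) i + b * snd (frame_U k p) i)"

definition horizontal_space :: "nat \<Rightarrow> jet \<Rightarrow> jet set" where
  "horizontal_space k p = {frame_comb k p a b | a b. True}"

definition euclidean_jet_dist :: "nat \<Rightarrow> jet \<Rightarrow> jet \<Rightarrow> real" where
  "euclidean_jet_dist k p q =
     sqrt ((fst p - fst q)\<^sup>2 + (\<Sum>i\<le>k. (snd p i - snd q i)\<^sup>2))"

(* D is a finite family of non-overlapping compact intervals [Inf K, Sup K] inside [a, b]. *)
definition abs_continuous_jet_curve :: "nat \<Rightarrow> real \<Rightarrow> real \<Rightarrow> (real \<Rightarrow> jet) \<Rightarrow> bool" where
  "abs_continuous_jet_curve k a b \<gamma> \<longleftrightarrow>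
     (\<forall>\<epsilon>>0. \<exists>\<delta>>0. \<forall>D. D division_of \<Union>D \<and> \<Union>D \<subseteq> {a..b} \<and> (\<Sum>K\<in>D. Sup K - Inf K) < \<delta>
        \<longrightarrow> (\<Sum>K\<in>D. euclidean_jet_dist k (\<gamma> (Inf K)) (\<gamma> (Sup K))) < \<epsilon>)"

definition has_jet_velocity :: "nat \<Rightarrow> real \<Rightarrow> real \<Rightarrow> (real \<Rightarrow> jet) \<Rightarrow> jet \<Rightarrow> real \<Rightarrow> bool" where
  "has_jet_velocity k a b \<gamma> v t \<longleftrightarrow>
     ((\<lambda>r. fst (\<gamma> r)) has_real_derivative fst v) (at t within {a..b}) \<and>
     (\<forall>i\<le>k. ((\<lambda>r. snd (\<gamma> r) i) has_real_derivative snd v i) (at t within {a..b}))"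

definition horizontal_curve :: "nat \<Rightarrow> real \<Rightarrow> real \<Rightarrow> (real \<Rightarrow> jet) \<Rightarrow> bool" where
  "horizontal_curve k a b \<gamma> \<longleftrightarrow>
     \<gamma> ` {a..b} \<subseteq> jet_space k \<and> abs_continuous_jet_curve k a b \<gamma> \<and>
     (AE t in lebesgue_on {a..b}. \<exists>v\<in>horizontal_space k (\<gamma> t). has_jet_velocity k a b \<gamma> v t)"

(* The frame is declared orthonormal and the vector a X + b d/du_k has x-component a and
   u_k-component b, so its norm is the square root of the sum of the squares of these two. *)
definition horizontal_length :: "nat \<Rightarrow> real \<Rightarrow> real \<Rightarrow> (real \<Rightarrow> jet) \<Rightarrow> ennreal" where
  "horizontal_length k a b \<gamma> =
     (\<integral>\<^sup>+t. ennreal (sqrt ((vector_derivative (\<lambda>r. fst (\<gamma> r)) (at t within {a..b}))\<^sup>2 +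
                        (vector_derivative (\<lambda>r. snd (\<gamma> r) k) (at t within {a..b}))\<^sup>2))
        \<partial>lebesgue_on {a..b})"

definition cc_dist :: "nat \<Rightarrow> jet \<Rightarrow> jet \<Rightarrow> ennreal" where
  "cc_dist k p q =
     Inf {horizontal_length k a b \<gamma> | a b \<gamma>.
            a \<le> b \<and> horizontal_curve k a b \<gamma> \<and> \<gamma> a = p \<and> \<gamma> b = q}"

abbreviation dim_Hau :: "nat \<Rightarrow> jet set \<Rightarrow> ereal" where
  "dim_Hau k \<equiv> hausdorff_dim (cc_dist k)"


section \<open>Jets of smooth functions, vertical and horizontal mappings\<close>

definition smooth_real :: "(real \<Rightarrow> real) \<Rightarrow> bool" where
  "smooth_real f \<longleftrightarrow> (\<forall>n x. (deriv ^^ n) f differentiable (at x))"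

definition jet_of :: "nat \<Rightarrow> (real \<Rightarrow> real) \<Rightarrow> real \<Rightarrow> jet" where
  "jet_of k f x = (x, \<lambda>i. if i \<le> k then (deriv ^^ i) f x else 0)"

definition vertical_map :: "nat \<Rightarrow> (real \<Rightarrow> real) \<Rightarrow> real \<Rightarrow> jet \<Rightarrow> jet" where
  "vertical_map k f t p =
     p \<otimes>\<^bsub>jet_group k\<^esub> (inv\<^bsub>jet_group k\<^esub> (jet_of k f (fst p - t)))"

definition horizontal_map :: "nat \<Rightarrow> (real \<Rightarrow> real) \<Rightarrow> real \<Rightarrow> jet \<Rightarrow> jet" where
  "horizontal_map k f t p = jet_of k f (fst p - t)"


section \<open>The jet space is a group and the vertical mapping takes values in \<open>{x = t}\<close>\<close>

lemma jet_mult_alt: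
  "jet_mult k p q = (fst p + fst q, \<lambda>s. if s \<le> k then snd q s +
     (\<Sum>j=s..k. snd p j * (fst q ^ (j - s) / fact (j - s))) else 0)"
  by (auto simp: jet_mult_def fun_eq_iff sum.atLeast_Suc_atMost)

lemma taylor_shift_add:
  fixes u :: "nat \<Rightarrow> real"
  shows "(\<Sum>j=s..k. (\<Sum>i=j..k. u i * (y ^ (i - j) / fact (i - j))) * (z ^ (j - s) / fact (j - s)))
       = (\<Sum>i=s..k. u i * ((y + z) ^ (i - s) / fact (i - s)))"
proof -
  have "(\<Sum>j=s..k. (\<Sum>i=j..k. u i * (y ^ (i - j) / fact (i - j))) * (z ^ (j - s) / fact (j - s)))
      = (\<Sum>j=s..k. \<Sum>i=j..k. u i * (y ^ (i - j) / fact (i - j)) * (z ^ (j - s) / fact (j - s)))"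
    by (simp only: sum_distrib_right)
  also have "\<dots> = (\<Sum>i=s..k. \<Sum>j=s..i. u i * (y ^ (i - j) / fact (i - j)) * (z ^ (j - s) / fact (j - s)))"
    by (simp add: sum.Sigma, rule sum.reindex_bij_witness[of _ prod.swap prod.swap]) auto
  also have "\<dots> = (\<Sum>i=s..k. u i * ((y + z) ^ (i - s) / fact (i - s)))"
  proof (rule sum.cong[OF refl])
    fix i assume i: "i \<in> {s..k}"
    have "(y + z) ^ (i - s) / fact (i - s)
        = (\<Sum>m\<le>i - s. z ^ m / fact m * (y ^ (i - s - m) / fact (i - s - m)))"
      unfolding add.commute[of y] binomial_ring sum_divide_distrib
      by (intro sum.cong) (simp_all add: binomial_fact)
    also have "\<dots> = (\<Sum>j=s..i. z ^ (j - s) / fact (j - s) * (y ^ (i - j) / fact (i - j)))"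
      using i by (intro sum.reindex_bij_witness[of _ "\<lambda>j. j - s" "\<lambda>m. m + s"]) (auto simp: add.commute)
    finally show "(\<Sum>j=s..i. u i * (y ^ (i - j) / fact (i - j)) * (z ^ (j - s) / fact (j - s)))
        = u i * ((y + z) ^ (i - s) / fact (i - s))"
      by (simp add: sum_distrib_left mult_ac)
  qed
  finally show ?thesis .
qed

lemma taylor_shift_zero:
  fixes u :: "nat \<Rightarrow> real"
  assumes "s \<le> k"
  shows "(\<Sum>j=s..k. u j * (0 ^ (j - s) / fact (j - s))) = u s"
proof -
  have "(\<Sum>j=s..k. u j * (0 ^ (j - s) / fact (j - s))) = (\<Sum>j=s..k. if j = s then u j else 0)"
    by (intro sum.cong) (auto simp: power_0_left)
  then show ?thesis using assms by simp
qed

lemma group_jet_group: "group (jet_group k)"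
proof (rule groupI)
  fix p q r :: jet
  have "snd r s + (\<Sum>j=s..k. (snd q j + (\<Sum>i=j..k. snd p i * (fst q ^ (i - j) / fact (i - j))))
            * (fst r ^ (j - s) / fact (j - s)))
      = snd r s + (\<Sum>j=s..k. snd q j * (fst r ^ (j - s) / fact (j - s)))
        + (\<Sum>j=s..k. snd p j * ((fst q + fst r) ^ (j - s) / fact (j - s)))" for s
    by (simp only: taylor_shift_add distrib_right sum.distrib add.assoc)
  then show "p \<otimes>\<^bsub>jet_group k\<^esub> q \<otimes>\<^bsub>jet_group k\<^esub> r = p \<otimes>\<^bsub>jet_group k\<^esub> (q \<otimes>\<^bsub>jet_group k\<^esub> r)"
    by (auto simp: jet_group_def jet_mult_alt fun_eq_iff)
next
  fix p assume p: "p \<in> carrier (jet_group k)"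
  define q where "q = (- fst p, \<lambda>s. if s \<le> k then
      - (\<Sum>j=s..k. snd p j * ((- fst p) ^ (j - s) / fact (j - s))) else 0)"
  have "(\<Sum>j=s..k. snd q j * (fst p ^ (j - s) / fact (j - s))) = - snd p s" if "s \<le> k" for s
  proof -
    have "(\<Sum>j=s..k. snd q j * (fst p ^ (j - s) / fact (j - s))) =
       - (\<Sum>j=s..k. (\<Sum>i=j..k. snd p i * ((- fst p) ^ (i - j) / fact (i - j))) * (fst p ^ (j - s) / fact (j - s)))"
      by (simp add: q_def sum_negf)
    also have "\<dots> = - snd p s"
      unfolding taylor_shift_add using taylor_shift_zero[OF that, of "snd p"] by simp
    finally show ?thesis .
  qed
  then have "jet_mult k q p = (0, \<lambda>_. 0)"
    by (auto simp: jet_mult_alt fun_eq_iff q_def)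
  moreover have "q \<in> jet_space k" by (auto simp: q_def jet_space_def)
  ultimately show "\<exists>y\<in>carrier (jet_group k). y \<otimes>\<^bsub>jet_group k\<^esub> p = \<one>\<^bsub>jet_group k\<^esub>"
    by (auto simp: jet_group_def)
qed (auto simp: jet_group_def jet_mult_alt jet_space_def fun_eq_iff prod_eq_iff)

lemma jet_of_in_jet_space: "jet_of k f x \<in> jet_space k"
  by (simp add: jet_of_def jet_space_def)

lemma fst_vertical_map: "fst (vertical_map k f t p) = t"
proof -
  interpret group "jet_group k" by (rule group_jet_group)
  let ?q = "jet_of k f (fst p - t)"
  have "?q \<in> carrier (jet_group k)"
    by (simp add: jet_group_def jet_of_in_jet_space)
  then have "fst (?q \<otimes>\<^bsub>jet_group k\<^esub> (inv\<^bsub>jet_group k\<^esub> ?q)) = 0"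
    by (subst r_inv) (auto simp: jet_group_def)
  then show ?thesis
    by (simp add: vertical_map_def jet_group_def jet_mult_def jet_of_def)
qed

end

theory Submission
  imports Defs
begin

text \<open>The horizontal mapping takes values on the jet curve of \<open>f\<close>, the vertical mapping takes
values in the hyperplane \<open>x = t\<close>. On each of the two sets there are coordinates \<open>u\<^sub>i\<close> with
integer weights \<open>w\<^sub>i\<close> for which the Carnot-Caratheodory distance is comparable, on bounded
sets, to \<open>max\<^sub>i \<bar>u\<^sub>i - v\<^sub>i\<bar> powr (1 / w\<^sub>i)\<close>: a single coordinate of weight 1 on the jet curve,
and the coordinates \<open>u\<^sub>0, ..., u\<^sub>k\<close> with weights \<open>k + 1 - i\<close> on the hyperplane. Two points of
the hyperplane differ by right multiplication with \<open>(0, v - u)\<close>, so that no twisting by the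
group law is left there.

The locale \<open>weighted_chart\<close> isolates this comparability, and everything about dimensions
is derived from it. With \<open>Q\<close> the sum of the weights, covering by boxes of side lengths \<open>2 powr
(- n * w\<^sub>i)\<close> bounds all dimensions by \<open>Q\<close>, which is 1 for the jet curve and \<open>(k + 1) * (k + 2)
/ 2\<close> for the hyperplane. For \<open>0 < \<beta> < Q\<close> a self-similar Cantor set with \<open>2 ^ Q\<close> pieces and
ratio \<open>2 powr (- Q / \<beta>)\<close> has dimension \<open>\<beta>\<close>; the value \<open>Q\<close> is attained by the whole set, which
contains all these Cantor sets, and 0 by a point.

The two factors can be prescribed independently of each other: if \<open>b\<close> lies in the
hyperplane, then the product of \<open>b\<close> with the jet of \<open>f\<close> at \<open>a\<close> has vertical image \<open>b\<close> and
horizontal image the jet at \<open>a\<close>. The product of a subset of the hyperplane with a piece of the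
jet curve therefore realises any pair of dimensions.

The comparability has two halves. The lower bound on the distance is an estimate of
coordinates along horizontal curves: translated to start at the identity, a curve of length at
most \<open>\<rho>\<close> satisfies \<open>\<bar>u\<^sub>k\<bar> \<le> \<rho>\<close>, and since the derivative of \<open>u\<^sub>i\<close> is that of \<open>x\<close> times
\<open>u\<^sub>i\<^sub>+\<^sub>1\<close>, successive integration gives \<open>\<bar>u\<^sub>i\<bar> \<le> \<rho> ^ (k + 1 - i)\<close>. The curves are only
absolutely continuous, which makes the fundamental theorem of calculus for such functions
necessary. The upper bound is an explicit curve which moves out by \<open>\<rho>\<close> in the \<open>x\<close>-direction and
back, along the jets of two different polynomials that agree to order \<open>k\<close> at the turning point.\<close>

section \<open>Hausdorff null sets and bounds on the Hausdorff dimension\<close>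

text \<open>Vanishing of the measure is the only information about it that enters the dimension, and
in this form it is free of suprema and infima.\<close>

lemma hausdorff_null_iff:
  "hausdorff_measure d s E = 0 \<longleftrightarrow>
     (\<forall>\<delta>>0. \<forall>\<epsilon>>0. \<exists>U :: nat \<Rightarrow> 'a set. E \<subseteq> (\<Union>i. U i) \<and>
        (\<forall>i. diam_wrt d (U i) \<le> ennreal \<delta>) \<and> (\<Sum>i. diam_power d s (U i)) < ennreal \<epsilon>)"
proof -
  have "hausdorff_premeasure d s \<delta> E = 0 \<longleftrightarrow>
     (\<forall>\<epsilon>>0. \<exists>U :: nat \<Rightarrow> 'a set. E \<subseteq> (\<Union>i. U i) \<and>
        (\<forall>i. diam_wrt d (U i) \<le> ennreal \<delta>) \<and> (\<Sum>i. diam_power d s (U i)) < ennreal \<epsilon>)"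
     (is "?l \<longleftrightarrow> ?r") for \<delta>
  proof
    assume ?l
    show ?r
    proof (intro allI impI)
      fix \<epsilon> :: real assume "\<epsilon> > 0"
      with \<open>?l\<close> have "hausdorff_premeasure d s \<delta> E < ennreal \<epsilon>" by (simp add: ennreal_less_zero_iff)
      then show "\<exists>U :: nat \<Rightarrow> 'a set. E \<subseteq> (\<Union>i. U i) \<and>
        (\<forall>i. diam_wrt d (U i) \<le> ennreal \<delta>) \<and> (\<Sum>i. diam_power d s (U i)) < ennreal \<epsilon>"
        unfolding hausdorff_premeasure_def Inf_less_iff by blast
    qed
  next
    assume r: ?r
    have "hausdorff_premeasure d s \<delta> E \<le> ennreal \<epsilon>" if "\<epsilon> > 0" for \<epsilon>
    proof -
      from r that obtain U :: "nat \<Rightarrow> 'a set" where U: "E \<subseteq> (\<Union>i. U i)"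
        "\<forall>i. diam_wrt d (U i) \<le> ennreal \<delta>" "(\<Sum>i. diam_power d s (U i)) < ennreal \<epsilon>" by blast
      then have "hausdorff_premeasure d s \<delta> E \<le> (\<Sum>i. diam_power d s (U i))"
        unfolding hausdorff_premeasure_def by (intro Inf_lower) blast
      with U show ?thesis by simp
    qed
    then have "hausdorff_premeasure d s \<delta> E \<le> 0" by - (rule ennreal_le_epsilon, simp)
    then show ?l by simp
  qed
  moreover have "hausdorff_measure d s E = 0 \<longleftrightarrow> (\<forall>\<delta>>0. hausdorff_premeasure d s \<delta> E = 0)"
    unfolding hausdorff_measure_def bot_ennreal[symmetric] by (auto simp: SUP_bot_conv)
  ultimately show ?thesis by simp
qed

lemma hausdorff_null_subset:
  assumes "E \<subseteq> F" "hausdorff_measure d s F = 0" shows "hausdorff_measure d s E = 0"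
  using assms unfolding hausdorff_null_iff by (meson subset_trans)

text \<open>The usual argument for countable subadditivity: the \<open>n\<close>-th set receives the share \<open>\<epsilon> / 2
^ (n + 2)\<close>, and the doubly indexed cover is enumerated by \<open>prod_decode\<close>.\<close>

lemma hausdorff_null_UN:
  fixes E :: "nat \<Rightarrow> 'a set"
  assumes "\<And>n. hausdorff_measure d s (E n) = 0"
  shows "hausdorff_measure d s (\<Union>n. E n) = 0"
  unfolding hausdorff_null_iff
proof (intro allI impI)
  fix \<delta> \<epsilon> :: real assume \<delta>: "\<delta> > 0" and \<epsilon>: "\<epsilon> > 0"
  have "\<exists>U :: nat \<Rightarrow> 'a set. E n \<subseteq> (\<Union>i. U i) \<and> (\<forall>i. diam_wrt d (U i) \<le> ennreal \<delta>) \<and>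
          (\<Sum>i. diam_power d s (U i)) < ennreal (\<epsilon>/2 * (1/2)^Suc n)" for n
    using assms[of n] \<delta> \<epsilon> unfolding hausdorff_null_iff by simp
  then obtain U :: "nat \<Rightarrow> nat \<Rightarrow> 'a set" where U: "\<And>n. E n \<subseteq> (\<Union>i. U n i)"
     "\<And>n i. diam_wrt d (U n i) \<le> ennreal \<delta>" "\<And>n. (\<Sum>i. diam_power d s (U n i)) < ennreal (\<epsilon>/2 * (1/2)^Suc n)"
    by metis
  define V where "V m = (case prod_decode m of (n, i) \<Rightarrow> U n i)" for m
  have "(\<Union>n. E n) \<subseteq> (\<Union>m. V m)"
  proof
    fix x assume "x \<in> (\<Union>n. E n)"
    then obtain n i where "x \<in> U n i" using U(1) by blast
    then have "x \<in> V (prod_encode (n, i))" by (simp add: V_def)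
    then show "x \<in> (\<Union>m. V m)" by blast
  qed
  moreover have "diam_wrt d (V m) \<le> ennreal \<delta>" for m using U(2) by (simp add: V_def split: prod.split)
  moreover have "(\<Sum>m. diam_power d s (V m)) < ennreal \<epsilon>"
  proof -
    have "(\<Sum>m. diam_power d s (V m)) = (\<Sum>n. \<Sum>i. diam_power d s (U n i))"
      using suminf_ennreal_2dimen[of "\<lambda>n. \<Sum>i. diam_power d s (U n i)" "\<lambda>(n, i). diam_power d s (U n i)"]
      by (simp add: V_def split_def)
    also have "\<dots> \<le> (\<Sum>n. ennreal (\<epsilon>/2 * (1/2)^Suc n))"
      using U(3) by (intro suminf_le) (auto simp: less_imp_le)
    also have "\<dots> = ennreal (\<epsilon>/2)"
    proof (rule suminf_ennreal_eq)
      show "(\<lambda>n. \<epsilon>/2 * (1/2)^Suc n) sums (\<epsilon>/2)"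
        using sums_mult[OF power_half_series, of "\<epsilon>/2"] by simp
    qed (use \<epsilon> in simp)
    also have "\<dots> < ennreal \<epsilon>" using \<epsilon> by (intro ennreal_lessI) auto
    finally show ?thesis .
  qed
  ultimately show "\<exists>U. (\<Union>n. E n) \<subseteq> \<Union> (range U) \<and>
      (\<forall>i::nat. diam_wrt d (U i) \<le> ennreal \<delta>) \<and> (\<Sum>i. diam_power d s (U i)) < ennreal \<epsilon>" by blast
qed

lemma hausdorff_dim_nonneg: "0 \<le> hausdorff_dim d E"
  unfolding hausdorff_dim_def by (rule Inf_greatest) (auto simp del: ereal_less_eq simp add: zero_ereal_def ereal_less_eq(3))

lemma hausdorff_dim_mono:
  assumes "E \<subseteq> F" shows "hausdorff_dim d E \<le> hausdorff_dim d F"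
  unfolding hausdorff_dim_def
  by (rule Inf_superset_mono) (use hausdorff_null_subset[OF assms] in blast)

lemma hausdorff_dim_leI:
  assumes "0 \<le> b" "\<And>s. b < s \<Longrightarrow> hausdorff_measure d s E = 0"
  shows "hausdorff_dim d E \<le> ereal b"
proof (rule ereal_le_epsilon2)
  fix e :: real assume "e > 0"
  then have "hausdorff_measure d (b + e) E = 0" using assms by simp
  then show "hausdorff_dim d E \<le> ereal b + ereal e"
    unfolding hausdorff_dim_def using \<open>e > 0\<close> assms(1) by (intro Inf_lower) auto
qed

lemma diam_wrt_leI: "(\<And>x y. x \<in> U \<Longrightarrow> y \<in> U \<Longrightarrow> d x y \<le> c) \<Longrightarrow> diam_wrt d U \<le> c"
  unfolding diam_wrt_def by (intro SUP_least)

text \<open>The cover at level \<open>n\<close> contributes at most a constant times \<open>(M * r powr s) ^ n\<close>, which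
tends to 0. This gives all upper bounds on dimensions.\<close>

lemma hausdorff_null_if_finite_covers:
  fixes V :: "nat \<Rightarrow> 'j \<Rightarrow> 'a set" and r C K M s :: real
  assumes r: "0 < r" "r < 1" and C: "0 < C" and s: "0 < s"
    and fin: "\<And>n. finite (J n)" and card: "\<And>n. real (card (J n)) \<le> K * M ^ n"
    and M: "0 \<le> M" "M * r powr s < 1"
    and cover: "\<And>n. E \<subseteq> (\<Union>j\<in>J n. V n j)"
    and diam: "\<And>n j x y. j \<in> J n \<Longrightarrow> x \<in> V n j \<Longrightarrow> y \<in> V n j \<Longrightarrow> d x y \<le> ennreal (C * r ^ n)"
  shows "hausdorff_measure d s E = 0"
  unfolding hausdorff_null_iff
proof (intro allI impI)
  fix \<delta> \<epsilon> :: real assume \<delta>: "\<delta> > 0" and \<epsilon>: "\<epsilon> > 0"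
  have "(\<lambda>n. C * r ^ n) \<longlonglongrightarrow> C * 0"
    using r by (intro tendsto_intros LIMSEQ_realpow_zero) auto
  then have 1: "\<forall>\<^sub>F n in sequentially. C * r ^ n < \<delta>"
    using \<delta> by (simp add: order_tendsto_iff)
  have "(\<lambda>n. K * C powr s * (M * r powr s) ^ n) \<longlonglongrightarrow> K * C powr s * 0"
    using M r by (intro tendsto_intros LIMSEQ_realpow_zero) auto
  then have 2: "\<forall>\<^sub>F n in sequentially. K * C powr s * (M * r powr s) ^ n < \<epsilon>"
    using \<epsilon> by (simp add: order_tendsto_iff)
  from eventually_conj[OF 1 2] obtain n where n: "C * r ^ n < \<delta>" "K * C powr s * (M * r powr s) ^ n < \<epsilon>"
    by (auto simp: eventually_sequentially)
  obtain h where h: "bij_betw h {..<card (J n)} (J n)"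
    using ex_bij_betw_nat_finite[OF fin[of n]] by (auto simp: atLeast0LessThan)
  define U where "U i = (if i < card (J n) then V n (h i) else {})" for i
  have hJ: "h i \<in> J n" if "i < card (J n)" for i using h that by (auto simp: bij_betw_def)
  have "E \<subseteq> (\<Union>i. U i)"
  proof
    fix x assume "x \<in> E"
    then obtain j where "j \<in> J n" "x \<in> V n j" using cover by blast
    moreover from \<open>j \<in> J n\<close> have "j \<in> h ` {..<card (J n)}" using bij_betw_imp_surj_on[OF h] by simp
    then obtain i where "i < card (J n)" "h i = j" by auto
    ultimately have "x \<in> U i" by (simp add: U_def)
    then show "x \<in> (\<Union>i. U i)" by blast
  qed
  moreover have dU: "diam_wrt d (U i) \<le> ennreal (C * r ^ n)" for i
    using diam[of "h i" n] hJ by (intro diam_wrt_leI) (auto simp: U_def split: if_splits)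
  moreover have "diam_wrt d (U i) \<le> ennreal \<delta>" for i
    using n(1) by (intro order_trans[OF dU] ennreal_leI) auto
  moreover have "(\<Sum>i. diam_power d s (U i)) < ennreal \<epsilon>"
  proof -
    have "(\<Sum>i. diam_power d s (U i)) = (\<Sum>i<card (J n). diam_power d s (U i))"
      by (rule suminf_finite) (simp_all add: U_def diam_power_def)
    also have "\<dots> \<le> (\<Sum>i<card (J n). ennreal ((C * r ^ n) powr s))"
    proof (intro sum_mono)
      fix i
      have "enn2real (diam_wrt d (U i)) \<le> C * r ^ n"
        using enn2real_mono[OF dU] C r by simp
      then show "diam_power d s (U i) \<le> ennreal ((C * r ^ n) powr s)"
        using s unfolding diam_power_def by (auto intro!: ennreal_leI powr_mono2)
    qed
    also have "\<dots> = ennreal (card (J n) * (C * r ^ n) powr s)"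
      by (simp add: ennreal_mult ennreal_of_nat_eq_real_of_nat)
    also have "\<dots> \<le> ennreal (K * M ^ n * (C * r ^ n) powr s)"
      by (intro ennreal_leI mult_right_mono card) auto
    also have "(C * r ^ n) powr s = C powr s * (r powr s) ^ n"
      using C r by (simp add: powr_mult powr_powr powr_realpow[symmetric] mult.commute)
    also have "K * M ^ n * (C powr s * (r powr s) ^ n) = K * C powr s * (M * r powr s) ^ n"
      by (simp add: power_mult_distrib mult_ac)
    also have "ennreal \<dots> < ennreal \<epsilon>" using n \<epsilon> by (simp add: ennreal_lessI)
    finally show ?thesis .
  qed
  ultimately show "\<exists>U. E \<subseteq> \<Union> (range U) \<and>
      (\<forall>i::nat. diam_wrt d (U i) \<le> ennreal \<delta>) \<and> (\<Sum>i. diam_power d s (U i)) < ennreal \<epsilon>" by blast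
qed

text \<open>Mass distribution by transport to the unit interval: a set of diameter \<open>D\<close> has an image
under \<open>g\<close> of length at most \<open>2 * c * D powr \<beta>\<close>, and these images cover an interval of Lebesgue
measure 1. The points are parametrised by \<open>P\<close> so that \<open>g\<close> may be given on codes of points
instead of on the points themselves.\<close>

lemma hausdorff_dim_ge_if_Hoelder_onto:
  fixes P :: "'s \<Rightarrow> 'a" and g :: "'s \<Rightarrow> real"
  assumes \<beta>: "0 < \<beta>" and c: "0 \<le> c"
    and hoelder: "\<And>\<sigma> \<tau> \<rho>. \<sigma> \<in> S \<Longrightarrow> \<tau> \<in> S \<Longrightarrow> 0 < \<rho> \<Longrightarrow> d (P \<sigma>) (P \<tau>) < ennreal \<rho> \<Longrightarrow>
            \<bar>g \<sigma> - g \<tau>\<bar> \<le> c * \<rho> powr \<beta>"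
    and onto: "{0..<1} \<subseteq> g ` S"
  shows "ereal \<beta> \<le> hausdorff_dim d (P ` S)"
  unfolding hausdorff_dim_def
proof (rule Inf_greatest, safe)
  fix s assume s: "0 \<le> s" and null: "hausdorff_measure d s (P ` S) = 0"
  show "ereal \<beta> \<le> ereal s"
  proof (rule ccontr)
    assume "\<not> ereal \<beta> \<le> ereal s"
    then have "s < \<beta>" by simp
    define \<epsilon> where "\<epsilon> = 1 / (2 * c + 1)"
    have \<epsilon>: "\<epsilon> > 0" "2 * c * \<epsilon> < 1" using c by (simp_all add: \<epsilon>_def)
    obtain U :: "nat \<Rightarrow> 'a set" where U: "P ` S \<subseteq> (\<Union>i. U i)" "\<And>i. diam_wrt d (U i) \<le> ennreal (1/2)"
       "(\<Sum>i. diam_power d s (U i)) < ennreal \<epsilon>"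
      using null[unfolded hausdorff_null_iff, rule_format, of "1/2" \<epsilon>] \<epsilon>(1) by auto
    define D where "D i = enn2real (diam_wrt d (U i))" for i
    have D: "0 \<le> D i" "D i \<le> 1/2" "diam_wrt d (U i) = ennreal (D i)" for i
    proof -
      show "diam_wrt d (U i) = ennreal (D i)" "0 \<le> D i"
        unfolding D_def using U(2)[of i]
        by (auto simp: ennreal_enn2real_if top_unique)
      then have "ennreal (D i) \<le> ennreal (1/2)" using U(2)[of i] by metis
      then show "D i \<le> 1/2" by (subst (asm) ennreal_le_iff) auto
    qed
    have close: "\<bar>g \<sigma> - g \<tau>\<bar> \<le> c * D i powr \<beta>" if "\<sigma> \<in> S" "\<tau> \<in> S" "P \<sigma> \<in> U i" "P \<tau> \<in> U i" for \<sigma> \<tau> i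
    \<comment> \<open>The hypothesis has a strict inequality, so it is used for all \<open>\<rho> > D i\<close> and the limit is taken.\<close>
    proof (rule tendsto_lowerbound)
      have "((\<lambda>\<rho>. c * \<rho> powr \<beta>) \<longlongrightarrow> c * D i powr \<beta>) (at (D i) within {0..})"
        using \<beta> D(1)[of i] by (intro tendsto_intros tendsto_powr') (auto simp: eventually_at_filter)
      then show "((\<lambda>\<rho>. c * \<rho> powr \<beta>) \<longlongrightarrow> c * D i powr \<beta>) (at_right (D i))"
        by (rule tendsto_within_subset) (use D(1)[of i] in auto)
      show "\<forall>\<^sub>F \<rho> in at_right (D i). \<bar>g \<sigma> - g \<tau>\<bar> \<le> c * \<rho> powr \<beta>"
        using eventually_at_right_less
      proof eventually_elim
        case (elim \<rho>)
        have "d (P \<sigma>) (P \<tau>) \<le> diam_wrt d (U i)"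
          unfolding diam_wrt_def using that by (meson SUP_upper2 order_refl)
        also have "\<dots> < ennreal \<rho>" using D(1)[of i] elim by (simp add: D(3) ennreal_lessI)
        finally show ?case using that elim D(1)[of i] by (intro hoelder) auto
      qed
    qed auto
    define z where "z i = g (SOME \<sigma>. \<sigma> \<in> S \<and> P \<sigma> \<in> U i)" for i
    define len where "len i = c * D i powr \<beta>" for i
    have len: "0 \<le> len i" for i using c by (simp add: len_def)
    define W where "W i = (if \<exists>\<sigma>\<in>S. P \<sigma> \<in> U i then {z i - len i .. z i + len i} else {})" for i
    have "{0..<1} \<subseteq> (\<Union>i. W i)"
    proof
      fix x :: real assume "x \<in> {0..<1}"
      then obtain \<sigma> where \<sigma>: "\<sigma> \<in> S" "x = g \<sigma>" using onto by blast
      then obtain i where i: "P \<sigma> \<in> U i" using U(1) by blast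
      let ?\<tau> = "SOME \<sigma>. \<sigma> \<in> S \<and> P \<sigma> \<in> U i"
      have "?\<tau> \<in> S \<and> P ?\<tau> \<in> U i" by (rule someI[of _ \<sigma>]) (use \<sigma> i in auto)
      then have "\<bar>g \<sigma> - z i\<bar> \<le> len i" unfolding z_def len_def using close \<sigma> i by blast
      then have "x \<in> W i" using \<sigma> i by (auto simp: W_def abs_le_iff)
      then show "x \<in> (\<Union>i. W i)" by blast
    qed
    then have "emeasure lborel {0..<1::real} \<le> emeasure lborel (\<Union>i. W i)"
      by (intro emeasure_mono) (auto simp: W_def)
    also have "\<dots> \<le> (\<Sum>i. emeasure lborel (W i))"
      by (intro emeasure_subadditive_countably) (auto simp: W_def)
    also have "\<dots> \<le> (\<Sum>i. ennreal (2 * c) * diam_power d s (U i))"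
    proof (intro suminf_le)
      fix i
      show "emeasure lborel (W i) \<le> ennreal (2 * c) * diam_power d s (U i)"
      proof (cases "\<exists>\<sigma>\<in>S. P \<sigma> \<in> U i")
        case True
        then have "U i \<noteq> {}" by auto
        \<comment> \<open>This is where diameters at most \<open>1/2\<close> matter: on bases at most 1 a smaller exponent gives a larger power.\<close>
        have "D i powr \<beta> \<le> (if s = 0 then 1 else D i powr s)"
          using D[of i] s \<beta> \<open>s < \<beta>\<close> powr_le1[of \<beta> "D i"] by (auto intro!: powr_mono')
        then have "len i \<le> c * (if s = 0 then 1 else D i powr s)"
          unfolding len_def using c by (intro mult_left_mono) auto
        then have "emeasure lborel (W i) \<le> ennreal (2 * c * (if s = 0 then 1 else D i powr s))"
          using True len[of i] by (auto simp: W_def intro!: ennreal_leI)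
        also have "\<dots> = ennreal (2 * c) * diam_power d s (U i)"
          using \<open>U i \<noteq> {}\<close> c by (auto simp: diam_power_def D_def[symmetric] ennreal_mult)
        finally show ?thesis .
      qed (simp add: W_def)
    qed auto
    also have "\<dots> = ennreal (2 * c) * (\<Sum>i. diam_power d s (U i))"
      by (rule ennreal_suminf_cmult)
    also have "\<dots> \<le> ennreal (2 * c) * ennreal \<epsilon>"
      using U(3) by (intro mult_left_mono) auto
    also have "\<dots> = ennreal (2 * c * \<epsilon>)" using c \<epsilon> by (simp add: ennreal_mult)
    also have "\<dots> < ennreal 1" using \<epsilon> by (intro ennreal_lessI) auto
    finally show False by simp
  qed
qed

section \<open>Series of digits\<close>

lemma bounded_digit_series:
  fixes e :: "nat \<Rightarrow> real"
  assumes q: "0 < q" "q < 1" and e: "\<And>m. \<bar>e m\<bar> \<le> B"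
  shows "summable (\<lambda>m. e m * q ^ m)" "\<bar>\<Sum>m. e m * q ^ m\<bar> \<le> B / (1 - q)"
proof -
  have geo: "(\<lambda>m. B * q ^ m) sums (B * (1 / (1 - q)))"
    using q by (intro sums_mult geometric_sums) auto
  have le: "norm (e m * q ^ m) \<le> B * q ^ m" for m
    using e[of m] q by (auto simp: abs_mult intro!: mult_right_mono)
  show "summable (\<lambda>m. e m * q ^ m)"
    by (rule summable_comparison_test'[OF sums_summable[OF geo] le])
  have "norm (\<Sum>m. e m * q ^ m) \<le> (\<Sum>m. B * q ^ m)"
    by (rule norm_suminf_le[OF le]) (rule sums_summable[OF geo])
  then show "\<bar>\<Sum>m. e m * q ^ m\<bar> \<le> B / (1 - q)" using sums_unique[OF geo] by simp
qed

lemma digit_series_shift: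
  fixes e :: "nat \<Rightarrow> real"
  assumes q: "0 < q" "q < 1" and e: "\<And>m. \<bar>e m\<bar> \<le> B" and z: "\<And>m. m < n \<Longrightarrow> e m = 0"
  shows "(\<Sum>m. e m * q ^ m) = q ^ n * (\<Sum>m. e (m + n) * q ^ m)"
proof -
  note s = bounded_digit_series(1)[of q e B, OF q e]
  have "(\<Sum>m. e m * q ^ m) = (\<Sum>m. e (m + n) * q ^ (m + n)) + (\<Sum>m<n. e m * q ^ m)"
    by (rule suminf_split_initial_segment[OF s])
  also have "(\<Sum>m<n. e m * q ^ m) = 0" using z by (intro sum.neutral) auto
  also have "(\<Sum>m. e (m + n) * q ^ (m + n)) = (\<Sum>m. q ^ n * (e (m + n) * q ^ m))"
    by (simp add: power_add mult_ac)
  also have "\<dots> = q ^ n * (\<Sum>m. e (m + n) * q ^ m)"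
    using bounded_digit_series(1)[of q "\<lambda>m. e (m + n)" B, OF q e] by (rule suminf_mult)
  finally show ?thesis by simp
qed

lemma digit_series_dist_le:
  fixes a b :: "nat \<Rightarrow> real"
  assumes q: "0 < q" "q < 1" and ab: "\<And>m. a m \<in> {0..B}" "\<And>m. b m \<in> {0..B}"
    and eq: "\<And>m. m < n \<Longrightarrow> a m = b m"
  shows "\<bar>(\<Sum>m. a m * q ^ m) - (\<Sum>m. b m * q ^ m)\<bar> \<le> q ^ n * (B / (1 - q))"
proof -
  have e: "\<bar>a m - b m\<bar> \<le> B" for m using ab(1)[of m] ab(2)[of m] by auto
  have "summable (\<lambda>m. a m * q ^ m)" "summable (\<lambda>m. b m * q ^ m)"
    using ab by (auto intro!: bounded_digit_series(1)[OF q, of _ B])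
  then have "(\<Sum>m. a m * q ^ m) - (\<Sum>m. b m * q ^ m) = (\<Sum>m. (a m - b m) * q ^ m)"
    by (simp add: suminf_diff left_diff_distrib)
  also have "\<dots> = q ^ n * (\<Sum>m. (a (m + n) - b (m + n)) * q ^ m)"
    using eq by (intro digit_series_shift[OF q e]) auto
  also have "\<bar>\<dots>\<bar> = q ^ n * \<bar>\<Sum>m. (a (m + n) - b (m + n)) * q ^ m\<bar>"
    using q by (simp add: abs_mult)
  also have "\<dots> \<le> q ^ n * (B / (1 - q))"
    using bounded_digit_series(2)[of q "\<lambda>m. a (m + n) - b (m + n)" B, OF q e] q
    by (intro mult_left_mono) auto
  finally show ?thesis .
qed

text \<open>The first digits that differ contribute at least \<open>q ^ n\<close>, of which the later ones cancel
at most \<open>N * q ^ (n + 1)\<close>. The bound degenerates for ordinary expansions, where \<open>N * q = 1\<close> and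
a carry can make all digits differ.\<close>

lemma digit_series_dist_ge:
  fixes a b :: "nat \<Rightarrow> nat"
  assumes q: "0 < q" "q < 1" and ab: "\<And>m. a m < N" "\<And>m. b m < N"
    and eq: "\<And>m. m < n \<Longrightarrow> a m = b m" and neq: "a n \<noteq> b n" and Nq: "N * q \<le> 1"
  shows "q ^ n * (1 - N * q) \<le> \<bar>(\<Sum>m. real (a m) * q ^ m) - (\<Sum>m. real (b m) * q ^ m)\<bar>"
proof -
  define e where "e m = real (a m) - real (b m)" for m
  have N: "N \<ge> 1" using ab(1)[of 0] by auto
  have e: "\<bar>e m\<bar> \<le> real N - 1" for m using ab(1)[of m] ab(2)[of m] by (auto simp: e_def)
  have "summable (\<lambda>m. real (a m) * q ^ m)" "summable (\<lambda>m. real (b m) * q ^ m)"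
    using less_imp_le[OF ab(1)] less_imp_le[OF ab(2)]
    by (auto intro!: bounded_digit_series(1)[OF q, of _ "real N"])
  then have "(\<Sum>m. real (a m) * q ^ m) - (\<Sum>m. real (b m) * q ^ m) = (\<Sum>m. e m * q ^ m)"
    by (simp add: suminf_diff left_diff_distrib e_def)
  also have "\<dots> = q ^ n * (\<Sum>m. e (m + n) * q ^ m)"
    using eq by (intro digit_series_shift[OF q e]) (auto simp: e_def)
  also have "(\<Sum>m. e (m + n) * q ^ m) = e n + q * (\<Sum>m. e (Suc m + n) * q ^ m)"
  proof -
    have s: "summable (\<lambda>m. e (m + n) * q ^ m)" by (rule bounded_digit_series(1)[OF q e])
    have s': "summable (\<lambda>m. e (Suc m + n) * q ^ m)" by (rule bounded_digit_series(1)[OF q e])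
    show ?thesis using suminf_split_head[OF s] suminf_mult[OF s', of q] by (simp add: mult_ac)
  qed
  finally have D: "\<bar>(\<Sum>m. real (a m) * q ^ m) - (\<Sum>m. real (b m) * q ^ m)\<bar>
        = q ^ n * \<bar>e n + q * (\<Sum>m. e (Suc m + n) * q ^ m)\<bar>"
    using q by (simp add: abs_mult)
  have "\<bar>\<Sum>m. e (Suc m + n) * q ^ m\<bar> \<le> (real N - 1) / (1 - q)"
    by (rule bounded_digit_series(2)[OF q e])
  also have "\<dots> \<le> real N"
    using Nq q by (simp add: field_simps)
  finally have T: "\<bar>q * (\<Sum>m. e (Suc m + n) * q ^ m)\<bar> \<le> N * q"
    using q mult_left_mono[of _ "real N" q] by (simp add: abs_mult mult.commute)
  have "1 \<le> \<bar>e n\<bar>" using neq by (auto simp: e_def)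
  then have "1 - N * q \<le> \<bar>e n\<bar> - \<bar>q * (\<Sum>m. e (Suc m + n) * q ^ m)\<bar>"
    using T by linarith
  also have "\<dots> \<le> \<bar>e n + q * (\<Sum>m. e (Suc m + n) * q ^ m)\<bar>" by linarith
  finally show ?thesis unfolding D using q by (intro mult_left_mono) auto
qed

text \<open>With \<open>D n = \<lfloor>x * M ^ n\<rfloor>\<close> the digits are \<open>D (n + 1) - M * D n\<close>, and the partial sums
telescope to \<open>D k / M ^ k\<close>.\<close>

lemma base_expansion_exists:
  fixes x :: real and M :: nat
  assumes M: "2 \<le> M" and x: "0 \<le> x" "x < 1"
  obtains a :: "nat \<Rightarrow> nat" where "\<And>n. a n < M" "(\<Sum>n. real (a n) / M * (1 / M) ^ n) = x"
proof -
  define D where "D n = \<lfloor>x * M ^ n\<rfloor>" for n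
  have D0: "D 0 = 0" using x by (auto simp: D_def floor_eq_iff)
  have dig: "0 \<le> D (Suc n) - M * D n \<and> D (Suc n) - M * D n < M" for n
  proof -
    have 1: "of_int (D n) \<le> x * M ^ n" "x * M ^ n < of_int (D n) + 1" by (auto simp: D_def)
    have "of_int (int M * D n) \<le> x * M ^ Suc n" using mult_left_mono[OF 1(1), of "real M"] by (simp add: mult_ac)
    then have "int M * D n \<le> D (Suc n)" unfolding D_def[of "Suc n"] le_floor_iff .
    moreover have "x * M ^ Suc n < of_int (int M * D n + int M)"
      using mult_strict_left_mono[OF 1(2), of "real M"] M by (simp add: algebra_simps)
    then have "D (Suc n) < int M * D n + int M" unfolding D_def[of "Suc n"] floor_less_iff .
    ultimately show ?thesis by linarith
  qed
  define a where "a n = nat (D (Suc n) - M * D n)" for n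
  have a: "a n < M" "real (a n) = of_int (D (Suc n)) - M * of_int (D n)" for n
    using dig[of n] by (auto simp: a_def nat_less_iff)
  have sum: "(\<Sum>n<k. real (a n) / M * (1 / M) ^ n) = of_int (D k) / M ^ k" for k
    using M by (induction k) (auto simp: D0 a(2) field_simps)
  have "(\<lambda>k. of_int (D k) / real M ^ k) \<longlonglongrightarrow> x"
  proof (rule tendsto_sandwich)
    have M': "0 < real M ^ k" for k using M by simp
    show "\<forall>\<^sub>F k in sequentially. x - (1 / real M) ^ k \<le> of_int (D k) / real M ^ k"
      using M'
    proof (intro always_eventually allI)
      fix k
      have "x * M ^ k - 1 \<le> of_int (D k)" unfolding D_def by linarith
      then have "(x * M ^ k - 1) / real M ^ k \<le> of_int (D k) / real M ^ k"
        using M'[of k] by (intro divide_right_mono) auto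
      then show "x - (1 / real M) ^ k \<le> of_int (D k) / real M ^ k" using M
        by (simp add: diff_divide_distrib power_one_over)
    qed
    show "\<forall>\<^sub>F k in sequentially. of_int (D k) / real M ^ k \<le> x"
      using M' by (intro always_eventually allI) (auto simp: D_def field_simps)
    have "(\<lambda>k. x - (1 / real M) ^ k) \<longlonglongrightarrow> x - 0"
      using M by (intro tendsto_intros LIMSEQ_realpow_zero) auto
    then show "(\<lambda>k. x - (1 / real M) ^ k) \<longlonglongrightarrow> x" by simp
  qed auto
  then have "(\<lambda>n. real (a n) / M * (1 / M) ^ n) sums x"
    unfolding sums_def sum by simp
  then show thesis using a(1) that by (auto simp: sums_iff)
qed

section \<open>Dimensions in weighted charts\<close>

text \<open>The map \<open>\<Psi>\<close> reads off points from coordinates in \<open>I\<close>, and \<open>d\<close> is comparable to the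
quasi-distance \<open>max\<^sub>i \<bar>u\<^sub>i - v\<^sub>i\<bar> powr (1 / w\<^sub>i)\<close>. Both estimates are phrased with a bound \<open>\<rho>\<close>
to avoid roots and powers of extended reals. The constant in the upper estimate may depend on a
bound \<open>R\<close> for the coordinates, because the jet curve of an arbitrary smooth function is only
locally Lipschitz.\<close>

locale weighted_chart =
  fixes d :: "'a \<Rightarrow> 'a \<Rightarrow> ennreal" and \<Psi> :: "(nat \<Rightarrow> real) \<Rightarrow> 'a" and I :: "nat set" and w :: "nat \<Rightarrow> nat"
  assumes finite_I: "finite I" and I_nonempty: "I \<noteq> {}" and w_pos: "\<And>i. i \<in> I \<Longrightarrow> 1 \<le> w i"
    and lower: "\<And>u v \<rho> i. 0 < \<rho> \<Longrightarrow> d (\<Psi> u) (\<Psi> v) < ennreal \<rho> \<Longrightarrow> i \<in> I \<Longrightarrow> \<bar>u i - v i\<bar> \<le> \<rho> ^ w i"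
    and upper: "\<And>R. \<exists>C>0. \<forall>u v \<rho>. (\<forall>i\<in>I. \<bar>u i\<bar> \<le> R \<and> \<bar>v i\<bar> \<le> R) \<longrightarrow> 0 < \<rho> \<longrightarrow>
            (\<forall>i\<in>I. \<bar>u i - v i\<bar> \<le> \<rho> ^ w i) \<longrightarrow> d (\<Psi> u) (\<Psi> v) \<le> ennreal (C * \<rho>)"
begin

definition total_weight :: nat where "total_weight = (\<Sum>i\<in>I. w i)"

lemma total_weight_pos: "1 \<le> total_weight"
proof -
  obtain i where "i \<in> I" using I_nonempty by blast
  then have "w i \<le> total_weight" unfolding total_weight_def using finite_I by (intro member_le_sum) auto
  then show ?thesis using w_pos[OF \<open>i \<in> I\<close>] by simp
qed

lemma weight_le_total_weight: "i \<in> I \<Longrightarrow> w i \<le> total_weight"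
  unfolding total_weight_def using finite_I by (intro member_le_sum) auto

text \<open>At level \<open>n\<close> the box is cut into cells of side length \<open>2 powr (- n * w\<^sub>i)\<close> in direction
\<open>i\<close>. There are of the order of \<open>2 ^ (n * total_weight)\<close> cells, of diameter comparable to \<open>2
powr (- n)\<close>.\<close>

lemma null_box:
  fixes m :: nat
  assumes s: "real total_weight < s"
  shows "hausdorff_measure d s (\<Psi> ` {u. \<forall>i\<in>I. \<bar>u i\<bar> \<le> real m}) = 0"
proof -
  obtain C where C: "C > 0" and up: "\<forall>u v \<rho>. (\<forall>i\<in>I. \<bar>u i\<bar> \<le> real m \<and> \<bar>v i\<bar> \<le> real m) \<longrightarrow> 0 < \<rho> \<longrightarrow>
          (\<forall>i\<in>I. \<bar>u i - v i\<bar> \<le> \<rho> ^ w i) \<longrightarrow> d (\<Psi> u) (\<Psi> v) \<le> ennreal (C * \<rho>)"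
    using upper[of "real m"] by (elim exE conjE)
  note upper' = up[rule_format]
  define N where "N n i = 2 * m * 2 ^ (w i * n)" for n i
  define J where "J n = PiE I (\<lambda>i. {0..N n i})" for n
  define V where "V n c = \<Psi> ` {u. \<forall>i\<in>I. \<bar>u i\<bar> \<le> real m \<and> real (c i) \<le> (u i + m) * 2 ^ (w i * n)
      \<and> (u i + m) * 2 ^ (w i * n) < real (c i) + 1}" for n and c :: "nat \<Rightarrow> nat"
  show ?thesis
  proof (rule hausdorff_null_if_finite_covers[where J = J and V = V and r = "1/2" and C = C
        and K = "(2 * real m + 1) ^ card I" and M = "2 ^ total_weight"])
    show "0 < s" using s by linarith
    show "finite (J n)" for n unfolding J_def using finite_I by (intro finite_PiE) auto
    show "real (card (J n)) \<le> (2 * real m + 1) ^ card I * (2 ^ total_weight) ^ n" for n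
    proof -
      have "real (card (J n)) = (\<Prod>i\<in>I. real (N n i) + 1)"
        unfolding J_def using finite_I by (simp add: card_PiE add.commute)
      also have "\<dots> \<le> (\<Prod>i\<in>I. (2 * real m + 1) * 2 ^ (w i * n))"
        by (intro prod_mono) (auto simp: N_def algebra_simps)
      also have "\<dots> = (2 * real m + 1) ^ card I * (\<Prod>i\<in>I. 2 ^ (w i * n))"
        by (simp add: prod.distrib)
      also have "(\<Prod>i\<in>I. (2::real) ^ (w i * n)) = (2 ^ total_weight) ^ n"
        unfolding total_weight_def by (simp add: power_sum power_mult prod_power_distrib)
      finally show ?thesis .
    qed
    have "2 ^ total_weight * (1/2) powr s = (2::real) powr (real total_weight - s)"
      by (simp add: powr_realpow[symmetric] powr_diff powr_divide)
    also have "\<dots> < 2 powr 0" using s by (subst powr_less_cancel_iff) auto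
    finally show "2 ^ total_weight * (1/2) powr s < (1::real)" by simp
    show "\<Psi> ` {u. \<forall>i\<in>I. \<bar>u i\<bar> \<le> real m} \<subseteq> (\<Union>c\<in>J n. V n c)" for n
    proof clarify
      fix u :: "nat \<Rightarrow> real" assume u: "\<forall>i\<in>I. \<bar>u i\<bar> \<le> real m"
      define x where "x i = (u i + m) * 2 ^ (w i * n)" for i
      define c where "c = restrict (\<lambda>i. nat \<lfloor>x i\<rfloor>) I"
      have x: "0 \<le> x i" "x i \<le> real (N n i)" if "i \<in> I" for i
      proof -
        have "0 \<le> u i + m" "u i + m \<le> 2 * m" using u that by (auto simp: abs_le_iff)
        then show "0 \<le> x i" "x i \<le> real (N n i)"
          unfolding x_def N_def by (auto intro!: mult_right_mono)
      qed
      have c: "real (c i) \<le> x i" "x i < real (c i) + 1" if "i \<in> I" for i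
        using x[OF that] that by (auto simp: c_def)
      have "c \<in> J n" unfolding J_def
      proof (rule PiE_I)
        fix i assume "i \<in> I"
        then have "real (c i) \<le> real (N n i)" using c(1) x(2) by (meson order_trans)
        then show "c i \<in> {0..N n i}" by simp
      qed (simp add: c_def)
      moreover have "\<Psi> u \<in> V n c" unfolding V_def using u c by (auto simp: x_def)
      ultimately show "\<Psi> u \<in> (\<Union>c\<in>J n. V n c)" by blast
    qed
    show "d x y \<le> ennreal (C * (1/2) ^ n)" if "x \<in> V n c" "y \<in> V n c" for n c x y
    proof -
      from that obtain u v where x: "x = \<Psi> u" and y: "y = \<Psi> v"
        and u: "\<And>i. i \<in> I \<Longrightarrow> \<bar>u i\<bar> \<le> real m \<and> real (c i) \<le> (u i + m) * 2 ^ (w i * n)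
             \<and> (u i + m) * 2 ^ (w i * n) < real (c i) + 1"
        and v: "\<And>i. i \<in> I \<Longrightarrow> \<bar>v i\<bar> \<le> real m \<and> real (c i) \<le> (v i + m) * 2 ^ (w i * n)
             \<and> (v i + m) * 2 ^ (w i * n) < real (c i) + 1"
        unfolding V_def by blast
      have "\<bar>u i - v i\<bar> \<le> ((1/2) ^ n) ^ w i" if "i \<in> I" for i
      proof -
        have "\<bar>(u i + m) * 2 ^ (w i * n) - (v i + m) * 2 ^ (w i * n)\<bar> \<le> 1"
          using u[OF that] v[OF that] by linarith
        moreover have "(u i + m) * 2 ^ (w i * n) - (v i + m) * 2 ^ (w i * n) = (u i - v i) * 2 ^ (w i * n)"
          by (simp add: algebra_simps)
        ultimately have "\<bar>u i - v i\<bar> * 2 ^ (w i * n) \<le> 1" by (simp add: abs_mult)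
        then have "\<bar>u i - v i\<bar> \<le> (1/2) ^ (w i * n)" by (simp add: field_simps)
        then show ?thesis by (simp add: power_mult[symmetric] mult.commute)
      qed
      then show ?thesis unfolding x y using u v by (intro upper') auto
    qed
  qed (use C in auto)
qed

lemma dim_le: "hausdorff_dim d (\<Psi> ` X) \<le> ereal (real total_weight)"
proof (rule hausdorff_dim_leI)
  fix s assume s: "real total_weight < s"
  have "hausdorff_measure d s (\<Union>m. \<Psi> ` {u. \<forall>i\<in>I. \<bar>u i\<bar> \<le> real m}) = 0"
    by (rule hausdorff_null_UN[OF null_box[OF s]])
  moreover have "\<Psi> ` X \<subseteq> (\<Union>m::nat. \<Psi> ` {u. \<forall>i\<in>I. \<bar>u i\<bar> \<le> real m})"
  proof clarify
    fix u assume "u \<in> X"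
    obtain m :: nat where "Max ((\<lambda>i. \<bar>u i\<bar>) ` I) \<le> real m" using real_arch_simple by blast
    then have "\<forall>i\<in>I. \<bar>u i\<bar> \<le> real m" using finite_I I_nonempty by (subst (asm) Max_le_iff) auto
    then show "\<Psi> u \<in> (\<Union>m::nat. \<Psi> ` {u. \<forall>i\<in>I. \<bar>u i\<bar> \<le> real m})" by blast
  qed
  ultimately show "hausdorff_measure d s (\<Psi> ` X) = 0" using hausdorff_null_subset by blast
qed simp

lemma dim_singleton: "hausdorff_dim d (\<Psi> ` {u}) = 0"
proof (rule antisym)
  have "hausdorff_dim d (\<Psi> ` {u}) \<le> ereal 0"
  proof (rule hausdorff_dim_leI)
    fix s :: real assume s: "0 < s"
    define R where "R = Max ((\<lambda>i. \<bar>u i\<bar>) ` I)"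
    have R: "\<bar>u i\<bar> \<le> R" if "i \<in> I" for i unfolding R_def using finite_I that by (intro Max_ge) auto
    obtain C where C: "C > 0" and up: "\<forall>u v \<rho>. (\<forall>i\<in>I. \<bar>u i\<bar> \<le> R \<and> \<bar>v i\<bar> \<le> R) \<longrightarrow> 0 < \<rho> \<longrightarrow>
            (\<forall>i\<in>I. \<bar>u i - v i\<bar> \<le> \<rho> ^ w i) \<longrightarrow> d (\<Psi> u) (\<Psi> v) \<le> ennreal (C * \<rho>)"
      using upper[of "R"] by (elim exE conjE)
    note upper' = up[rule_format]
    show "hausdorff_measure d s (\<Psi> ` {u}) = 0"
    proof (rule hausdorff_null_if_finite_covers[where J = "\<lambda>_. {()}" and V = "\<lambda>_ _. {\<Psi> u}" and r = "1/2" and C = C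
        and K = 1 and M = 1])
      have "(1/2) powr s < (1/2::real) powr 0" using s by (intro powr_less_mono') auto
      then show "1 * (1/2::real) powr s < 1" by simp
      show "d x y \<le> ennreal (C * (1/2) ^ n)" if "x \<in> {\<Psi> u}" "y \<in> {\<Psi> u}" for x y n
        using that R upper'[of u u "(1/2)^n"] by auto
    qed (use C s in auto)
  qed simp
  then show "hausdorff_dim d (\<Psi> ` {u}) \<le> 0" by (simp add: zero_ereal_def)
qed (rule hausdorff_dim_nonneg)

text \<open>The Cantor set consists of the points whose \<open>i\<close>-th coordinate is a series of digits below
\<open>2 ^ w i\<close> in powers of \<open>r ^ w i\<close>. A point is coded by a sequence over the alphabet \<open>A\<close> of all
digit tuples, which has \<open>2 ^ total_weight\<close> letters. If two codes first differ at position \<open>n\<close>,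
then the distance of the points is comparable to \<open>r ^ n\<close>: the upper estimate by
\<open>digit_series_dist_le\<close>, the lower one by \<open>digit_series_dist_ge\<close>, which applies since \<open>2 * r <
1\<close>. Words of length \<open>n\<close> give the covers. For the lower bound the code is read as an expansion
in base \<open>2 ^ total_weight\<close>, which is a \<open>\<beta>\<close>-Hoelder map onto the unit interval because \<open>2 ^
total_weight = r powr (- \<beta>)\<close>.\<close>

lemma exists_cantor_set:
  assumes \<beta>: "0 < \<beta>" "\<beta> < real total_weight"
  shows "\<exists>X. hausdorff_dim d (\<Psi> ` X) = ereal \<beta>"
proof -
  define r where "r = 2 powr (- (real total_weight / \<beta>))"
  have "r < 2 powr (-1)" unfolding r_def using \<beta> by (intro powr_less_mono) (auto simp: field_simps)
  then have r: "0 < r" "r < 1/2" by (auto simp: r_def powr_minus)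
  have rpow: "(2::real) ^ total_weight = r powr (- \<beta>)"
    using \<beta> by (simp add: r_def powr_powr powr_realpow)
  define A where "A = PiE I (\<lambda>i. {..<(2::nat) ^ w i})"
  have finA: "finite A" unfolding A_def using finite_I by (intro finite_PiE) auto
  have cardA: "card A = 2 ^ total_weight"
    unfolding A_def using finite_I by (simp add: card_PiE total_weight_def power_sum)
  have A_less: "a i < 2 ^ w i" if "a \<in> A" "i \<in> I" for a i using that by (auto simp: A_def PiE_def Pi_def)
  define S where "S = {\<sigma> :: nat \<Rightarrow> nat \<Rightarrow> nat. \<forall>n. \<sigma> n \<in> A}"
  have SA: "\<sigma> n \<in> A" if "\<sigma> \<in> S" for \<sigma> n using that by (simp add: S_def)
  define \<Phi> where "\<Phi> \<sigma> i = (\<Sum>n. real (\<sigma> n i) * (r ^ w i) ^ n)" for \<sigma> :: "nat \<Rightarrow> nat \<Rightarrow> nat" and i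

  have q: "0 < r ^ w i" "r ^ w i < 1" "r ^ w i \<le> 1/2" "2 ^ w i * r ^ w i \<le> 2 * r"
     "(2::real) ^ w i / (1 - r ^ w i) \<le> 4 ^ w i" if "i \<in> I" for i
  proof -
    have w: "1 \<le> w i" using w_pos that .
    show "0 < r ^ w i" using r by simp
    have "r ^ w i \<le> r ^ 1" using r w by (intro power_decreasing) auto
    then show h: "r ^ w i \<le> 1/2" using r by simp
    then show "r ^ w i < 1" by simp
    have "(2 * r) ^ w i \<le> (2 * r) ^ 1" using r w by (intro power_decreasing) auto
    then show "2 ^ w i * r ^ w i \<le> 2 * r" by (simp add: power_mult_distrib)
    have "(2::real) ^ 1 \<le> 2 ^ w i" using w by (intro power_increasing) auto
    then have "2 ^ w i * 2 \<le> 2 ^ w i * (2::real) ^ w i" by (intro mult_left_mono) auto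
    also have "\<dots> = 4 ^ w i" by (simp add: power_mult_distrib[symmetric])
    finally have "2 ^ w i * 2 \<le> (4::real) ^ w i" .
    moreover have "(2::real) ^ w i / (1 - r ^ w i) \<le> 2 ^ w i / (1/2)"
      using h by (intro divide_left_mono) auto
    ultimately show "(2::real) ^ w i / (1 - r ^ w i) \<le> 4 ^ w i" by simp
  qed
  have digit: "real (\<sigma> n i) \<in> {0..2 ^ w i}" if "\<sigma> \<in> S" "i \<in> I" for \<sigma> n i
    using A_less[OF SA[OF that(1)] that(2), of n] by (simp add: less_imp_le)

  have \<Phi>_bound: "\<bar>\<Phi> \<sigma> i\<bar> \<le> 4 ^ total_weight" if "\<sigma> \<in> S" "i \<in> I" for \<sigma> i
  proof -
    have "\<bar>\<Phi> \<sigma> i\<bar> \<le> 2 ^ w i / (1 - r ^ w i)"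
      unfolding \<Phi>_def
      by (rule bounded_digit_series(2)[OF q(1,2)[OF that(2)]]) (use digit[OF that] in simp)
    also have "\<dots> \<le> 4 ^ w i" using q that by blast
    also have "\<dots> \<le> 4 ^ total_weight" using weight_le_total_weight[OF that(2)] by (intro power_increasing) auto
    finally show ?thesis .
  qed
  have \<Phi>_le: "\<bar>\<Phi> \<sigma> i - \<Phi> \<tau> i\<bar> \<le> (4 * r ^ n) ^ w i"
    if "\<sigma> \<in> S" "\<tau> \<in> S" "i \<in> I" "\<And>m. m < n \<Longrightarrow> \<sigma> m = \<tau> m" for \<sigma> \<tau> i n
  proof -
    have "\<bar>\<Phi> \<sigma> i - \<Phi> \<tau> i\<bar> \<le> (r ^ w i) ^ n * (2 ^ w i / (1 - r ^ w i))"
      unfolding \<Phi>_def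
      by (rule digit_series_dist_le[OF q(1,2)[OF that(3)]]) (use digit that in auto)
    also have "\<dots> \<le> (r ^ w i) ^ n * 4 ^ w i"
      using q[OF that(3)] by (intro mult_left_mono) auto
    also have "\<dots> = (4 * r ^ n) ^ w i"
      by (simp add: power_mult_distrib power_mult[symmetric] mult.commute)
    finally show ?thesis .
  qed
  \<comment> \<open>Since \<open>c \<le> 1\<close>, the power \<open>c ^ w i\<close> is a lower bound for the gap factor in every coordinate.\<close>
  define c where "c = 1 - 2 * r"
  have c: "0 < c" "c \<le> 1" using r by (auto simp: c_def)
  have \<Phi>_ge: "\<exists>i\<in>I. (c * r ^ n) ^ w i \<le> \<bar>\<Phi> \<sigma> i - \<Phi> \<tau> i\<bar>"
    if "\<sigma> \<in> S" "\<tau> \<in> S" "\<And>m. m < n \<Longrightarrow> \<sigma> m = \<tau> m" "\<sigma> n \<noteq> \<tau> n" for \<sigma> \<tau> n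
  proof -
    have "\<exists>i\<in>I. \<sigma> n i \<noteq> \<tau> n i"
    proof (rule ccontr)
      assume "\<not> (\<exists>i\<in>I. \<sigma> n i \<noteq> \<tau> n i)"
      then have "\<sigma> n = \<tau> n"
        by (intro PiE_ext[OF SA[OF that(1), unfolded A_def] SA[OF that(2), unfolded A_def]]) blast
      with that(4) show False by contradiction
    qed
    then obtain i where i: "i \<in> I" "\<sigma> n i \<noteq> \<tau> n i" by blast
    have N: "2 ^ w i * r ^ w i \<le> 1" using q(4)[OF i(1)] r by linarith
    have "c ^ w i \<le> c ^ 1" using c w_pos[OF i(1)] by (intro power_decreasing) auto
    also have "\<dots> \<le> 1 - 2 ^ w i * r ^ w i" using q(4)[OF i(1)] by (simp add: c_def)
    finally have "(r ^ w i) ^ n * c ^ w i \<le> (r ^ w i) ^ n * (1 - real (2 ^ w i) * r ^ w i)"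
      using r by (intro mult_left_mono) auto
    also have "\<dots> \<le> \<bar>\<Phi> \<sigma> i - \<Phi> \<tau> i\<bar>"
      unfolding \<Phi>_def
      by (rule digit_series_dist_ge[OF q(1,2)[OF i(1)]])
         (use A_less[OF SA[OF that(1)] i(1)] A_less[OF SA[OF that(2)] i(1)] that(3) i(2) N in auto)
    also have "(r ^ w i) ^ n * c ^ w i = (c * r ^ n) ^ w i"
      by (simp add: power_mult_distrib power_mult[symmetric] mult.commute)
    finally show ?thesis using i(1) by blast
  qed

  have "hausdorff_dim d ((\<lambda>\<sigma>. \<Psi> (\<Phi> \<sigma>)) ` S) \<le> ereal \<beta>"
  proof (rule hausdorff_dim_leI)
    fix s assume s: "\<beta> < s"
    obtain C where C: "C > 0" and up: "\<forall>u v \<rho>. (\<forall>i\<in>I. \<bar>u i\<bar> \<le> 4 ^ total_weight \<and> \<bar>v i\<bar> \<le> 4 ^ total_weight) \<longrightarrow> 0 < \<rho> \<longrightarrow>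
        (\<forall>i\<in>I. \<bar>u i - v i\<bar> \<le> \<rho> ^ w i) \<longrightarrow> d (\<Psi> u) (\<Psi> v) \<le> ennreal (C * \<rho>)"
      using upper[of "4 ^ total_weight"] by (elim exE conjE)
    define J where "J n = PiE {..<n} (\<lambda>_::nat. A)" for n
    define V where "V n a = (\<lambda>\<sigma>. \<Psi> (\<Phi> \<sigma>)) ` {\<sigma> \<in> S. \<forall>m<n. \<sigma> m = a m}" for n and a :: "nat \<Rightarrow> nat \<Rightarrow> nat"
    show "hausdorff_measure d s ((\<lambda>\<sigma>. \<Psi> (\<Phi> \<sigma>)) ` S) = 0"
    proof (rule hausdorff_null_if_finite_covers[where J = J and V = V and r = r and C = "C * 4"
          and K = 1 and M = "2 ^ total_weight"])
      show "finite (J n)" for n unfolding J_def using finA by (intro finite_PiE) auto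
      show "real (card (J n)) \<le> 1 * (2 ^ total_weight) ^ n" for n
        unfolding J_def by (simp add: card_PiE cardA)
      have "2 ^ total_weight * r powr s = r powr (s - \<beta>)" unfolding rpow by (simp add: powr_add[symmetric])
      also have "\<dots> < r powr 0" using r s by (intro powr_less_mono') auto
      finally show "2 ^ total_weight * r powr s < 1" using r by simp
      show "(\<lambda>\<sigma>. \<Psi> (\<Phi> \<sigma>)) ` S \<subseteq> (\<Union>a\<in>J n. V n a)" for n
      proof clarify
        fix \<sigma> assume "\<sigma> \<in> S"
        then have "restrict \<sigma> {..<n} \<in> J n" "\<Psi> (\<Phi> \<sigma>) \<in> V n (restrict \<sigma> {..<n})"
          using SA by (auto simp: J_def V_def)
        then show "\<Psi> (\<Phi> \<sigma>) \<in> (\<Union>a\<in>J n. V n a)" by blast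
      qed
      show "d x y \<le> ennreal (C * 4 * r ^ n)" if xy: "x \<in> V n a" "y \<in> V n a" for n a x y
      proof -
        obtain \<sigma> \<tau> where st: "\<sigma> \<in> S" "\<tau> \<in> S" "x = \<Psi> (\<Phi> \<sigma>)" "y = \<Psi> (\<Phi> \<tau>)" "\<And>m. m < n \<Longrightarrow> \<sigma> m = \<tau> m"
          using xy by (auto simp: V_def)
        have "d (\<Psi> (\<Phi> \<sigma>)) (\<Psi> (\<Phi> \<tau>)) \<le> ennreal (C * (4 * r ^ n))"
          by (rule up[rule_format]) (use st \<Phi>_bound \<Phi>_le r in auto)
        then show ?thesis by (simp add: st mult.assoc)
      qed
    qed (use C r s \<beta> in auto)
  qed (use \<beta> in simp)
  moreover have "ereal \<beta> \<le> hausdorff_dim d ((\<lambda>\<sigma>. \<Psi> (\<Phi> \<sigma>)) ` S)"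
  proof -
    obtain h where h: "bij_betw h A {..<(2::nat) ^ total_weight}"
      using ex_bij_betw_finite_nat[OF finA] by (auto simp: cardA atLeast0LessThan)
    define M where "M = (2::nat) ^ total_weight"
    have "(2::nat) ^ 1 \<le> 2 ^ total_weight" using total_weight_pos by (intro power_increasing) auto
    then have M: "2 \<le> M" by (simp add: M_def)
    have Mr: "real M = r powr (-\<beta>)" by (simp add: M_def rpow)
    define g where "g \<sigma> = (\<Sum>n. real (h (\<sigma> n)) / M * (1 / M) ^ n)" for \<sigma> :: "nat \<Rightarrow> nat \<Rightarrow> nat"
    have hM: "h a < M" if "a \<in> A" for a using bij_betwE[OF h] that by (auto simp: M_def)
    have h01: "real (h (\<sigma> n)) / M \<in> {0..1}" if "\<sigma> \<in> S" for \<sigma> n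
      using hM[OF SA[OF that, of n]] by simp
    show ?thesis
    proof (rule hausdorff_dim_ge_if_Hoelder_onto[where g = g and c = "2 * (1 / c) powr \<beta>"])
      show "0 < \<beta>" "0 \<le> 2 * (1 / c) powr \<beta>" using \<beta> by auto
      show "{0..<1} \<subseteq> g ` S"
      proof
        fix x :: real assume "x \<in> {0..<1}"
        then obtain a where a: "\<And>n. a n < M" "(\<Sum>n. real (a n) / M * (1 / M) ^ n) = x"
          using base_expansion_exists[OF M, of x] by auto
        define \<sigma> where "\<sigma> n = inv_into A h (a n)" for n
        have im: "h ` A = {..<M}" using bij_betw_imp_surj_on[OF h] by (simp add: M_def)
        have an: "a n \<in> h ` A" for n using a(1)[of n] im by simp
        have "\<sigma> n \<in> A" "h (\<sigma> n) = a n" for n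
          using inv_into_into[OF an] f_inv_into_f[OF an] by (simp_all add: \<sigma>_def)
        then have "\<sigma> \<in> S" "g \<sigma> = x" using a(2) by (auto simp: S_def g_def)
        then show "x \<in> g ` S" by blast
      qed
      fix \<sigma> \<tau> \<rho> assume st: "\<sigma> \<in> S" "\<tau> \<in> S" and \<rho>: "0 < \<rho>" and dd: "d (\<Psi> (\<Phi> \<sigma>)) (\<Psi> (\<Phi> \<tau>)) < ennreal \<rho>"
      show "\<bar>g \<sigma> - g \<tau>\<bar> \<le> 2 * (1 / c) powr \<beta> * \<rho> powr \<beta>"
      proof (cases "\<sigma> = \<tau>")
        case False
        define n where "n = (LEAST n. \<sigma> n \<noteq> \<tau> n)"
        have "\<exists>n. \<sigma> n \<noteq> \<tau> n" using False by auto
        then have n: "\<sigma> n \<noteq> \<tau> n" unfolding n_def by (rule LeastI_ex)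
        have n': "\<sigma> m = \<tau> m" if "m < n" for m using not_less_Least that unfolding n_def by blast
        obtain i where i: "i \<in> I" "(c * r ^ n) ^ w i \<le> \<bar>\<Phi> \<sigma> i - \<Phi> \<tau> i\<bar>"
          using \<Phi>_ge[OF st n' n] by blast
        have "(c * r ^ n) ^ w i \<le> \<rho> ^ w i" using i lower[OF \<rho> dd i(1)] by linarith
        then have "c * r ^ n \<le> \<rho>" using \<rho> w_pos[OF i(1)] by (subst (asm) power_mono_iff) (use c r in auto)
        then have rn: "r ^ n \<le> (1 / c) * \<rho>" using c by (simp add: field_simps)
        have M1: "0 < 1 / real M" "1 / real M < 1" "1 / (1 - 1 / real M) \<le> 2"
          using M by (auto simp: field_simps)
        have "\<bar>g \<sigma> - g \<tau>\<bar> \<le> (1 / real M) ^ n * (1 / (1 - 1 / real M))"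
          unfolding g_def by (rule digit_series_dist_le[OF M1(1,2)]) (use h01 st n' in auto)
        also have "\<dots> \<le> (1 / real M) ^ n * 2" using M1 by (intro mult_left_mono) auto
        also have "1 / real M = r powr \<beta>" unfolding Mr using r by (simp add: powr_minus field_simps)
        also have "(r powr \<beta>) ^ n = (r ^ n) powr \<beta>"
          using r by (simp add: powr_powr powr_realpow[symmetric] mult.commute)
        also have "(r ^ n) powr \<beta> * 2 \<le> ((1 / c) * \<rho>) powr \<beta> * 2"
          using rn r \<beta> by (intro mult_right_mono powr_mono2) auto
        also have "\<dots> = 2 * (1 / c) powr \<beta> * \<rho> powr \<beta>"
          by (subst powr_mult) (use c \<rho> in auto)
        finally show ?thesis .
      qed simp
    qed
  qed
  moreover have "(\<lambda>\<sigma>. \<Psi> (\<Phi> \<sigma>)) ` S = \<Psi> ` \<Phi> ` S" by (simp add: image_image)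
  ultimately show ?thesis by (metis antisym)
qed

text \<open>The gaps keep the dimension of the Cantor sets below \<open>total_weight\<close>, so that this value
is only reached as the supremum of the dimensions of subsets.\<close>

lemma dim_UNIV: "hausdorff_dim d (range \<Psi>) = ereal (real total_weight)"
proof (rule antisym[OF dim_le])
  show "ereal (real total_weight) \<le> hausdorff_dim d (range \<Psi>)"
  proof (rule ereal_le_real)
    fix z assume "hausdorff_dim d (range \<Psi>) \<le> ereal z"
    show "ereal (real total_weight) \<le> ereal z"
    proof (rule ccontr)
      assume "\<not> ereal (real total_weight) \<le> ereal z"
      then have "max 0 z < real total_weight" using total_weight_pos by auto
      then obtain \<beta> where \<beta>: "max 0 z < \<beta>" "\<beta> < real total_weight" using dense by blast
      then obtain X where X: "hausdorff_dim d (\<Psi> ` X) = ereal \<beta>" using exists_cantor_set[of \<beta>] by auto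
      have "hausdorff_dim d (\<Psi> ` X) \<le> hausdorff_dim d (range \<Psi>)" by (rule hausdorff_dim_mono) auto
      then have "ereal \<beta> \<le> ereal z"
        using \<open>hausdorff_dim d (range \<Psi>) \<le> ereal z\<close> unfolding X by (rule order_trans)
      then show False using \<beta> by simp
    qed
  qed
qed

lemma exists_set_of_dim:
  assumes "0 \<le> \<beta>" "\<beta> \<le> real total_weight"
  shows "\<exists>X. X \<noteq> {} \<and> hausdorff_dim d (\<Psi> ` X) = ereal \<beta>"
proof -
  consider "\<beta> = 0" | "\<beta> = real total_weight" | "0 < \<beta>" "\<beta> < real total_weight" using assms by linarith
  then show ?thesis
  proof cases
    case 1 then show ?thesis using dim_singleton[of "\<lambda>_. 0"] by (intro exI[of _ "{\<lambda>_. 0}"]) (simp add: zero_ereal_def)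
  next
    case 2 then show ?thesis using dim_UNIV by (intro exI[of _ UNIV]) simp
  next
    case 3
    then obtain X where X: "hausdorff_dim d (\<Psi> ` X) = ereal \<beta>" using exists_cantor_set by blast
    moreover have "X \<noteq> {}"
    proof
      assume "X = {}"
      then have "hausdorff_dim d (\<Psi> ` X) \<le> hausdorff_dim d (\<Psi> ` {\<lambda>_. 0})" by (intro hausdorff_dim_mono) auto
      then have "ereal \<beta> \<le> 0" unfolding X dim_singleton .
      then show False using 3 by (simp add: zero_ereal_def)
    qed
    ultimately show ?thesis by blast
  qed
qed

end

section \<open>The fundamental theorem of calculus for absolutely continuous functions\<close>

text \<open>The Henstock-Kurzweil proof. Tags outside of the null set \<open>N\<close> are handled by
differentiability as in the classical theorem. At tags in \<open>N\<close> the derivative is replaced by 0,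
and the gauge forces the intervals into an open set \<open>T\<close> of small measure containing \<open>N\<close>, where
absolute continuity bounds the total increment of \<open>h\<close>.\<close>

lemma fundamental_theorem_abs_continuous:
  fixes h h' :: "real \<Rightarrow> real"
  assumes ab: "a \<le> b"
    and ac: "\<And>\<epsilon>. \<epsilon> > 0 \<Longrightarrow> \<exists>\<delta>>0. \<forall>D. D division_of \<Union>D \<and> \<Union>D \<subseteq> {a..b} \<and> (\<Sum>K\<in>D. Sup K - Inf K) < \<delta>
                \<longrightarrow> (\<Sum>K\<in>D. \<bar>h (Sup K) - h (Inf K)\<bar>) < \<epsilon>"
    and N: "negligible N"
    and deriv: "\<And>s. s \<in> {a..b} - N \<Longrightarrow> (h has_real_derivative h' s) (at s within {a..b})"
  shows "(h' has_integral (h b - h a)) {a..b}"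
proof -
  define g where "g s = (if s \<in> N then 0 else h' s)" for s
  have "(g has_integral (h b - h a)) {a..b}"
    unfolding has_integral_real
  proof (intro allI impI)
    fix e :: real assume e: "e > 0"
    define \<eta> where "\<eta> = e / (2 * (b - a + 1))"
    have \<eta>: "\<eta> > 0" using e ab by (simp add: \<eta>_def)
    have "\<eta> * (b - a) < e / 2" using e ab by (simp add: \<eta>_def field_simps)
    obtain \<delta> where \<delta>: "\<delta> > 0" and ac': "\<And>D. D division_of \<Union>D \<Longrightarrow> \<Union>D \<subseteq> {a..b} \<Longrightarrow> (\<Sum>K\<in>D. Sup K - Inf K) < \<delta>
                \<Longrightarrow> (\<Sum>K\<in>D. \<bar>h (Sup K) - h (Inf K)\<bar>) < e/2"
      using ac[of "e/2"] e by auto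
    have "N \<in> sets lebesgue" "N \<in> null_sets lebesgue"
      using N negligible_iff_null_sets by auto
    then obtain T where T: "open T" "N \<subseteq> T" "T - N \<in> lmeasurable" "emeasure lebesgue (T - N) < ennreal \<delta>"
      using sets_lebesgue_outer_open \<delta> by blast
    have Tm: "T \<in> lmeasurable" "measure lebesgue T < \<delta>"
    proof -
      have TT: "T = (T - N) \<union> N" using T by auto
      show "T \<in> lmeasurable" using T(3) \<open>N \<in> null_sets lebesgue\<close>
        by (metis TT fmeasurable.Un negligible_imp_measurable negligible_iff_null_sets)
      then have "emeasure lebesgue T = emeasure lebesgue (T - N)"
        using \<open>N \<in> null_sets lebesgue\<close> by (simp add: emeasure_Diff_null_set fmeasurableD)
      then have "emeasure lebesgue T < ennreal \<delta>" using T by simp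
      then show "measure lebesgue T < \<delta>" using \<open>T \<in> lmeasurable\<close> \<delta>
        by (simp add: emeasure_eq_measure2 ennreal_less_iff)
    qed
    have "\<exists>d>0. (s \<in> N \<longrightarrow> ball s d \<subseteq> T) \<and> (s \<in> {a..b} - N \<longrightarrow>
            (\<forall>y\<in>{a..b}. \<bar>y - s\<bar> < d \<longrightarrow> \<bar>h y - h s - (y - s) * h' s\<bar> \<le> \<eta> * \<bar>y - s\<bar>))" for s
    proof (cases "s \<in> N")
      case True
      then obtain d where "d > 0" "ball s d \<subseteq> T" using T openE by blast
      then show ?thesis using True by auto
    next
      case False
      show ?thesis
      proof (cases "s \<in> {a..b}")
        case True
        with False deriv have "(h has_derivative (*) (h' s)) (at s within {a..b})"
          by (auto simp: has_field_derivative_def)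
        then obtain d where "d>0" "\<forall>y\<in>{a..b}. norm (y - s) < d \<longrightarrow> norm (h y - h s - h' s * (y - s)) \<le> \<eta> * norm (y - s)"
          unfolding has_derivative_within_alt using \<eta> by blast
        then show ?thesis using False by (intro exI[of _ d]) (auto simp: mult.commute)
      next
        case False with \<open>s \<notin> N\<close> show ?thesis by (intro exI[of _ 1]) auto
      qed
    qed
    then obtain d where d: "\<And>s. d s > 0" "\<And>s. s \<in> N \<Longrightarrow> ball s (d s) \<subseteq> T"
       "\<And>s y. s \<in> {a..b} - N \<Longrightarrow> y \<in> {a..b} \<Longrightarrow> \<bar>y - s\<bar> < d s \<Longrightarrow> \<bar>h y - h s - (y - s) * h' s\<bar> \<le> \<eta> * \<bar>y - s\<bar>"
      by metis
    show "\<exists>\<gamma>. gauge \<gamma> \<and> (\<forall>\<D>. \<D> tagged_division_of {a..b} \<and> \<gamma> fine \<D> \<longrightarrow>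
              norm ((\<Sum>(x, k)\<in>\<D>. measure lborel k *\<^sub>R g x) - (h b - h a)) < e)"
    proof (intro exI[of _ "\<lambda>s. ball s (d s)"] conjI allI impI)
      show "gauge (\<lambda>s. ball s (d s))" using d(1) gauge_ball_dependent by blast
      fix p assume "p tagged_division_of {a..b} \<and> (\<lambda>s. ball s (d s)) fine p"
      then have p: "p tagged_division_of {a..b}" and fine: "(\<lambda>s. ball s (d s)) fine p" by auto
      define err where "err x K = \<bar>measure lborel K * g x - (h (Sup K) - h (Inf K))\<bar>" for x K
      \<comment> \<open>The bad part of the tagged division, whose total length is at most the measure of \<open>T\<close>.\<close>
      define B where "B = {(x, K) \<in> p. x \<in> N}"
      have fin: "finite p" using p by auto
      have pK: "\<exists>u v. K = {u..v} \<and> u \<le> v \<and> u \<le> x \<and> x \<le> v \<and> a \<le> u \<and> v \<le> b \<and> Inf K = u \<and> Sup K = v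
           \<and> measure lborel K = v - u \<and> {u..v} \<subseteq> ball x (d x)"
        if xK: "(x, K) \<in> p" for x K
      proof -
        obtain u v where K: "K = cbox u v" using tagged_division_ofD(4)[OF p xK] by blast
        have "x \<in> K" "K \<subseteq> {a..b}" using tagged_division_ofD(2,3)[OF p xK] by auto
        moreover have "K \<subseteq> ball x (d x)" using fine xK by (auto simp: fine_def)
        ultimately show ?thesis using K by (intro exI[of _ u] exI[of _ v]) auto
      qed
      have good: "err x K \<le> \<eta> * measure lborel K" if xK: "(x, K) \<in> p" "x \<notin> N" for x K
      proof -
        obtain u v where uv: "K = {u..v}" "u \<le> v" "u \<le> x" "x \<le> v" "a \<le> u" "v \<le> b" "Inf K = u" "Sup K = v"
           "measure lborel K = v - u" "{u..v} \<subseteq> ball x (d x)" using pK[OF xK(1)] by blast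
        have "u \<in> {u..v}" "v \<in> {u..v}" using uv(2) by auto
        then have "u \<in> ball x (d x)" "v \<in> ball x (d x)" using uv(10) by blast+
        then have 1: "\<bar>h u - h x - (u - x) * h' x\<bar> \<le> \<eta> * \<bar>u - x\<bar>" "\<bar>h v - h x - (v - x) * h' x\<bar> \<le> \<eta> * \<bar>v - x\<bar>"
          using d(3)[of x u] d(3)[of x v] xK(2) uv by (auto simp: dist_real_def)
        have "err x K = \<bar>(h u - h x - (u - x) * h' x) - (h v - h x - (v - x) * h' x)\<bar>"
          using xK(2) by (simp add: err_def uv g_def algebra_simps)
        also have "\<dots> \<le> \<eta> * \<bar>u - x\<bar> + \<eta> * \<bar>v - x\<bar>" using 1 by linarith
        also have "\<dots> = \<eta> * measure lborel K" using uv by (simp add: algebra_simps)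
        finally show ?thesis .
      qed
      have Bp: "B \<subseteq> p" by (auto simp: B_def)
      have Btag: "B tagged_partial_division_of {a..b}"
        using p Bp tagged_partial_division_subset tagged_division_of_def by blast
      have Bdiv: "(snd ` B) division_of \<Union>(snd ` B)"
        using Btag partial_division_of_tagged_division by blast
      have Bself: "B tagged_division_of \<Union>(snd ` B)"
        using Btag by (rule tagged_partial_division_of_Union_self)
      have over: "(\<Sum>(x,K)\<in>B. D K) = (\<Sum>K\<in>snd ` B. D K)" if D: "\<And>u. D {u..u} = 0" for D :: "real set \<Rightarrow> real"
      proof -
        define D' where "D' K = (if K = {} then 0 else D K)" for K
        have "(\<Sum>(x,K)\<in>B. D' K) = (\<Sum>K\<in>snd ` B. D' K)"
        proof (rule sum.over_tagged_division_lemma[OF Bself])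
          fix u v :: real assume "box u v = {}"
          then have "v \<le> u" by simp
          then show "D' (cbox u v) = 0" using D[of u] by (cases "u = v") (auto simp: D'_def)
        qed
        moreover have ne: "K \<noteq> {}" if "(x, K) \<in> B" for x K
          using that Bp pK by fastforce
        moreover have "(\<Sum>(x,K)\<in>B. D' K) = (\<Sum>(x,K)\<in>B. D K)"
          using ne by (intro sum.cong) (auto simp: D'_def)
        moreover have "(\<Sum>K\<in>snd ` B. D' K) = (\<Sum>K\<in>snd ` B. D K)"
          using ne by (intro sum.cong) (auto simp: D'_def)
        ultimately show ?thesis by simp
      qed
      have "(\<Sum>K\<in>snd ` B. Sup K - Inf K) = (\<Sum>K\<in>snd ` B. measure lborel K)"
      proof (intro sum.cong refl)
        fix K assume "K \<in> snd ` B"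
        then obtain x where "(x, K) \<in> p" using Bp by auto
        from pK[OF this] show "Sup K - Inf K = measure lborel K" by auto
      qed
      also have "\<dots> = measure lebesgue (\<Union>(snd ` B))"
      proof -
        have "((\<lambda>x. 1::real) has_integral (\<Sum>K\<in>snd ` B. measure lborel K)) (\<Union>(snd ` B))"
        proof (rule has_integral_combine_division[OF Bdiv])
          fix K assume "K \<in> snd ` B"
          then obtain x where "(x, K) \<in> p" using Bp by auto
          from pK[OF this] obtain u v where "K = {u..v}" by auto
          then show "((\<lambda>x. 1::real) has_integral measure lborel K) K"
            using has_integral_const_real[of "1::real" u v] by simp
        qed
        then show ?thesis
          by (metis has_integral_iff lmeasurable_iff_integrable_on lmeasure_integral)
      qed
      also have "\<dots> \<le> measure lebesgue T"
      proof (rule measure_mono_fmeasurable)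
        show "\<Union>(snd ` B) \<subseteq> T"
        proof clarsimp
          fix y x K assume "(x, K) \<in> B" "y \<in> K"
          then show "y \<in> T" using pK[of x K] d(2)[of x] by (auto simp: B_def)
        qed
        show "\<Union>(snd ` B) \<in> sets lebesgue" 
        proof (rule sets.finite_Union)
          show "finite (snd ` B)" using Bdiv by blast
          show "snd ` B \<subseteq> sets lebesgue" using division_ofD(4)[OF Bdiv] by fastforce
        qed
      qed (rule Tm)
      also have "\<dots> < \<delta>" by (rule Tm)
      finally have "(\<Sum>K\<in>snd ` B. Sup K - Inf K) < \<delta>" .
      moreover have "\<Union>(snd ` B) \<subseteq> {a..b}"
        using Btag unfolding tagged_partial_division_of_def by fastforce
      ultimately have "(\<Sum>K\<in>snd ` B. \<bar>h (Sup K) - h (Inf K)\<bar>) < e/2"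
        by (intro ac'[OF Bdiv])
      then have "(\<Sum>(x,K)\<in>B. \<bar>h (Sup K) - h (Inf K)\<bar>) < e/2"
        using over[of "\<lambda>K. \<bar>h (Sup K) - h (Inf K)\<bar>"] by simp
      moreover have "(\<Sum>(x,K)\<in>B. err x K) = (\<Sum>(x,K)\<in>B. \<bar>h (Sup K) - h (Inf K)\<bar>)"
        by (intro sum.cong) (auto simp: B_def err_def g_def)
      ultimately have bad: "(\<Sum>(x,K)\<in>B. err x K) < e/2" by simp
      have "(\<Sum>(x,K)\<in>p - B. err x K) \<le> (\<Sum>(x,K)\<in>p - B. \<eta> * measure lborel K)"
        using good by (intro sum_mono) (auto simp: B_def)
      also have "\<dots> \<le> (\<Sum>(x,K)\<in>p. \<eta> * measure lborel K)"
        using fin \<eta> by (intro sum_mono2) auto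
      also have "\<dots> = \<eta> * (\<Sum>(x,K)\<in>p. measure lborel K)" by (simp add: sum_distrib_left split_def)
      also have "\<dots> = \<eta> * (b - a)"
        using additive_content_tagged_division[of p a b] p ab by simp
      finally have "(\<Sum>(x,K)\<in>p - B. err x K) < e/2" using \<open>\<eta> * (b - a) < e / 2\<close> by linarith
      moreover have "(\<Sum>(x,K)\<in>p. err x K) = (\<Sum>(x,K)\<in>p - B. err x K) + (\<Sum>(x,K)\<in>B. err x K)"
        using sum.subset_diff[OF Bp fin] by blast
      ultimately have tot: "(\<Sum>(x,K)\<in>p. err x K) < e" using bad by linarith
      have "(\<Sum>(x, k)\<in>p. measure lborel k *\<^sub>R g x) - (h b - h a) = (\<Sum>(x, K)\<in>p. measure lborel K * g x - (h (Sup K) - h (Inf K)))"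
        using additive_tagged_division_1[OF ab p, of h] by (simp add: split_def sum_subtractf)
      then have "norm ((\<Sum>(x, k)\<in>p. measure lborel k *\<^sub>R g x) - (h b - h a)) \<le> (\<Sum>(x,K)\<in>p. err x K)"
        by (simp add: err_def split_def sum_abs)
      then show "norm ((\<Sum>(x, k)\<in>p. measure lborel k *\<^sub>R g x) - (h b - h a)) < e" using tot by linarith
    qed
  qed
  then show ?thesis
    by (rule has_integral_spike[OF N, rotated]) (auto simp: g_def)
qed

section \<open>Lower bounds on the Carnot-Caratheodory distance\<close>

lemma euclidean_jet_dist_ge:
  shows "\<bar>fst p - fst q\<bar> \<le> euclidean_jet_dist k p q"
    and "i \<le> k \<Longrightarrow> \<bar>snd p i - snd q i\<bar> \<le> euclidean_jet_dist k p q"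
proof -
  have "(fst p - fst q)\<^sup>2 \<le> (fst p - fst q)\<^sup>2 + (\<Sum>i\<le>k. (snd p i - snd q i)\<^sup>2)"
    by (simp add: sum_nonneg)
  then show "\<bar>fst p - fst q\<bar> \<le> euclidean_jet_dist k p q"
    unfolding euclidean_jet_dist_def by (intro real_le_rsqrt) simp
  assume i: "i \<le> k"
  have "(snd p i - snd q i)\<^sup>2 \<le> (\<Sum>i\<le>k. (snd p i - snd q i)\<^sup>2)"
    using i by (intro member_le_sum) auto
  then have "(snd p i - snd q i)\<^sup>2 \<le> (fst p - fst q)\<^sup>2 + (\<Sum>i\<le>k. (snd p i - snd q i)\<^sup>2)"
    by (simp add: add_increasing)
  then show "\<bar>snd p i - snd q i\<bar> \<le> euclidean_jet_dist k p q"
    unfolding euclidean_jet_dist_def by (intro real_le_rsqrt) simp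
qed

lemma horizontal_space_snd:
  assumes "v \<in> horizontal_space k p" "i < k"
  shows "snd v i = fst v * snd p (Suc i)"
  using assms by (auto simp: horizontal_space_def frame_comb_def frame_X_def frame_U_def)

text \<open>The norm of a horizontal vector for the metric that makes the frame orthonormal.\<close>

definition horizontal_speed :: "nat \<Rightarrow> jet \<Rightarrow> real" where
  "horizontal_speed k v = sqrt ((fst v)\<^sup>2 + (snd v k)\<^sup>2)"

lemma horizontal_speed_ge: "\<bar>fst v\<bar> \<le> horizontal_speed k v" "\<bar>snd v k\<bar> \<le> horizontal_speed k v"
  unfolding horizontal_speed_def by (auto intro!: real_le_rsqrt)

text \<open>A function that is Lipschitz along an absolutely continuous curve is absolutely
continuous itself.\<close>

lemma Lipschitz_along_curve_has_integral:
  assumes ac: "abs_continuous_jet_curve k a b \<gamma>" and c: "a \<le> c" "c \<le> b" and L: "0 \<le> L"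
    and lip: "\<And>s s'. s \<in> {a..b} \<Longrightarrow> s' \<in> {a..b} \<Longrightarrow> \<bar>y s - y s'\<bar> \<le> L * euclidean_jet_dist k (\<gamma> s) (\<gamma> s')"
    and N: "negligible N"
    and deriv: "\<And>s. s \<in> {a..b} - N \<Longrightarrow> (y has_real_derivative D s) (at s within {a..b})"
  shows "(D has_integral (y c - y a)) {a..c}"
proof (rule fundamental_theorem_abs_continuous[OF c(1) _ N])
  fix e :: real assume e: "e > 0"
  then have "e / (L + 1) > 0" using L by simp
  from ac[unfolded abs_continuous_jet_curve_def, rule_format, OF this]
  obtain \<delta> where \<delta>: "\<delta> > 0" and ac': "\<And>D. D division_of \<Union>D \<Longrightarrow> \<Union>D \<subseteq> {a..b} \<Longrightarrow> (\<Sum>K\<in>D. Sup K - Inf K) < \<delta>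
      \<Longrightarrow> (\<Sum>K\<in>D. euclidean_jet_dist k (\<gamma> (Inf K)) (\<gamma> (Sup K))) < e / (L + 1)"
    by auto
  show "\<exists>\<delta>>0. \<forall>D. D division_of \<Union>D \<and> \<Union>D \<subseteq> {a..c} \<and> (\<Sum>K\<in>D. Sup K - Inf K) < \<delta>
          \<longrightarrow> (\<Sum>K\<in>D. \<bar>y (Sup K) - y (Inf K)\<bar>) < e"
  proof (intro exI[of _ \<delta>] conjI allI impI \<delta>)
    fix D :: "real set set" assume D: "D division_of \<Union>D \<and> \<Union>D \<subseteq> {a..c} \<and> (\<Sum>K\<in>D. Sup K - Inf K) < \<delta>"
    then have Dab: "\<Union>D \<subseteq> {a..b}" using c by fastforce
    have "(\<Sum>K\<in>D. \<bar>y (Sup K) - y (Inf K)\<bar>) \<le> (\<Sum>K\<in>D. L * euclidean_jet_dist k (\<gamma> (Inf K)) (\<gamma> (Sup K)))"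
    proof (rule sum_mono)
      fix K assume K: "K \<in> D"
      obtain u v where uv: "K = cbox u v" "K \<noteq> {}"
        using division_ofD(3,4)[of D "\<Union>D" K] D K by blast
      then have "u \<le> v" by auto
      then have ends: "Inf K = u" "Sup K = v" and "u \<in> K" "v \<in> K" using uv by auto
      moreover have "K \<subseteq> {a..b}" using Dab K by blast
      ultimately have "u \<in> {a..b}" "v \<in> {a..b}" by blast+
      from lip[OF this] show "\<bar>y (Sup K) - y (Inf K)\<bar> \<le> L * euclidean_jet_dist k (\<gamma> (Inf K)) (\<gamma> (Sup K))"
        unfolding ends by (simp add: abs_minus_commute)
    qed
    also have "\<dots> = L * (\<Sum>K\<in>D. euclidean_jet_dist k (\<gamma> (Inf K)) (\<gamma> (Sup K)))"
      by (simp add: sum_distrib_left)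
    also have "\<dots> \<le> L * (e / (L + 1))"
      using ac'[of D] D Dab L by (intro mult_left_mono) (auto simp: less_imp_le)
    also have "\<dots> < e" using L e by (simp add: field_simps)
    finally show "(\<Sum>K\<in>D. \<bar>y (Sup K) - y (Inf K)\<bar>) < e" .
  qed
next
  fix s assume "s \<in> {a..c} - N"
  then show "(y has_real_derivative D s) (at s within {a..c})"
    using c by (intro DERIV_subset[OF deriv]) auto
qed

text \<open>Integrating a bound of the derivative by the speed. The length is an integral of a
function that is not known to be measurable beforehand, and for such a function the nonnegative
integral is only a lower integral. Measurability comes from the fundamental theorem, applied to
\<open>x\<close> and \<open>u\<^sub>k\<close>: their derivatives are integrable in the sense of Henstock and Kurzweil, hence
measurable.\<close>

lemma increment_along_horizontal_curve:
  assumes \<gamma>: "horizontal_curve k a b \<gamma>" and len: "horizontal_length k a b \<gamma> < ennreal \<rho>"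
    and c: "a \<le> c" "c \<le> b" and L: "0 \<le> L" and K: "0 \<le> K" and \<rho>: "0 < \<rho>"
    and lip: "\<And>s s'. s \<in> {a..b} \<Longrightarrow> s' \<in> {a..b} \<Longrightarrow> \<bar>y s - y s'\<bar> \<le> L * euclidean_jet_dist k (\<gamma> s) (\<gamma> s')"
    and deriv: "\<And>s v. s \<in> {a..b} \<Longrightarrow> v \<in> horizontal_space k (\<gamma> s) \<Longrightarrow> has_jet_velocity k a b \<gamma> v s \<Longrightarrow>
        \<exists>D. (y has_real_derivative D) (at s within {a..b}) \<and> \<bar>D\<bar> \<le> K * horizontal_speed k v"
  shows "\<bar>y c - y a\<bar> \<le> K * \<rho>"
proof (cases "a < b")
  case False
  then have "c = a" using c by auto
  then show ?thesis using K \<rho> by simp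
next
  case ab: True
  have ac: "abs_continuous_jet_curve k a b \<gamma>" using \<gamma> by (simp add: horizontal_curve_def)
  have "AE s in lebesgue. s \<in> {a..b} \<longrightarrow> (\<exists>v\<in>horizontal_space k (\<gamma> s). has_jet_velocity k a b \<gamma> v s)"
    using \<gamma> by (simp add: horizontal_curve_def AE_restrict_space_iff)
  then obtain N where N: "N \<in> null_sets lebesgue"
    "{s. \<not> (s \<in> {a..b} \<longrightarrow> (\<exists>v\<in>horizontal_space k (\<gamma> s). has_jet_velocity k a b \<gamma> v s))} \<subseteq> N"
    unfolding eventually_ae_filter by auto
  then have negl: "negligible N" by (simp add: negligible_iff_null_sets)
  have "\<exists>v D. s \<in> {a..b} - N \<longrightarrow> v \<in> horizontal_space k (\<gamma> s) \<and> has_jet_velocity k a b \<gamma> v s \<and>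
           (y has_real_derivative D) (at s within {a..b}) \<and> \<bar>D\<bar> \<le> K * horizontal_speed k v" for s
  proof (cases "s \<in> {a..b} - N")
    case True
    then obtain v where v: "v \<in> horizontal_space k (\<gamma> s)" "has_jet_velocity k a b \<gamma> v s" using N(2) by blast
    then obtain D where "(y has_real_derivative D) (at s within {a..b})" "\<bar>D\<bar> \<le> K * horizontal_speed k v"
      using deriv[of s v] True by blast
    with v show ?thesis by blast
  qed blast
  then obtain v D where vD: "\<And>s. s \<in> {a..b} - N \<Longrightarrow> v s \<in> horizontal_space k (\<gamma> s) \<and> has_jet_velocity k a b \<gamma> (v s) s \<and>
           (y has_real_derivative D s) (at s within {a..b}) \<and> \<bar>D s\<bar> \<le> K * horizontal_speed k (v s)"
    by metis
  define X where "X s = (if s \<in> N then 0 else fst (v s))" for s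
  define U where "U s = (if s \<in> N then 0 else snd (v s) k)" for s
  define D' where "D' s = (if s \<in> N then 0 else D s)" for s
  define \<sigma> where "\<sigma> s = sqrt ((X s)\<^sup>2 + (U s)\<^sup>2)" for s
  have \<sigma>0: "0 \<le> \<sigma> s" for s by (simp add: \<sigma>_def)
  have velX: "((\<lambda>r. fst (\<gamma> r)) has_real_derivative X s) (at s within {a..b})"
    and velU: "((\<lambda>r. snd (\<gamma> r) k) has_real_derivative U s) (at s within {a..b})" if "s \<in> {a..b} - N" for s
    using vD[OF that] that by (auto simp: has_jet_velocity_def X_def U_def)
  have "(X has_integral (fst (\<gamma> b) - fst (\<gamma> a))) {a..b}"
    by (rule Lipschitz_along_curve_has_integral[OF ac _ _ _ _ negl velX, of b 1])
       (use ab euclidean_jet_dist_ge in auto)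
  then have Xm: "X \<in> borel_measurable (lebesgue_on {a..b})"
    by (intro integrable_imp_measurable) (auto simp: integrable_on_def)
  have "(U has_integral (snd (\<gamma> b) k - snd (\<gamma> a) k)) {a..b}"
    by (rule Lipschitz_along_curve_has_integral[OF ac _ _ _ _ negl velU, of b 1])
       (use ab euclidean_jet_dist_ge in auto)
  then have Um: "U \<in> borel_measurable (lebesgue_on {a..b})"
    by (intro integrable_imp_measurable) (auto simp: integrable_on_def)
  have \<sigma>m: "\<sigma> \<in> borel_measurable (lebesgue_on {a..b})"
    unfolding \<sigma>_def using Xm Um by measurable
  have "AE s in lebesgue. s \<notin> N" using N(1) by (rule AE_not_in)
  then have AEN: "AE s in lebesgue_on {a..b}. s \<in> {a..b} - N"
    by (auto simp: AE_restrict_space_iff elim: eventually_mono)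
  have "horizontal_length k a b \<gamma> = (\<integral>\<^sup>+s. ennreal (\<sigma> s) \<partial>lebesgue_on {a..b})"
    unfolding horizontal_length_def
  proof (rule nn_integral_cong_AE, use AEN in eventually_elim)
    case (elim s)
    have "vector_derivative (\<lambda>r. fst (\<gamma> r)) (at s within {a..b}) = X s"
      "vector_derivative (\<lambda>r. snd (\<gamma> r) k) (at s within {a..b}) = U s"
      using elim velX[OF elim] velU[OF elim] ab
      by (auto intro!: vector_derivative_within_closed_interval simp: has_real_derivative_iff_has_vector_derivative)
    then show ?case by (simp add: \<sigma>_def)
  qed
  with len have nn: "(\<integral>\<^sup>+s. ennreal (\<sigma> s) \<partial>lebesgue_on {a..b}) < ennreal \<rho>" by simp
  have \<sigma>i: "integrable (lebesgue_on {a..b}) \<sigma>"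
  proof (rule integrableI_bounded[OF \<sigma>m])
    have "(\<integral>\<^sup>+s. ennreal (norm (\<sigma> s)) \<partial>lebesgue_on {a..b}) < ennreal \<rho>" using nn \<sigma>0 by simp
    then show "(\<integral>\<^sup>+s. ennreal (norm (\<sigma> s)) \<partial>lebesgue_on {a..b}) < \<infinity>"
      by (rule order.strict_trans) (simp add: ennreal_less_top)
  qed
  have "ennreal (integral\<^sup>L (lebesgue_on {a..b}) \<sigma>) < ennreal \<rho>"
    using nn nn_integral_eq_integral[OF \<sigma>i] \<sigma>0 by simp
  then have "integral\<^sup>L (lebesgue_on {a..b}) \<sigma> \<le> \<rho>"
    using \<rho> by (simp add: ennreal_less_iff Bochner_Integration.integral_nonneg \<sigma>0)
  moreover have \<sigma>hk: "\<sigma> integrable_on {a..b}"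
    using integrable_on_lebesgue_on[OF \<sigma>i] by simp
  ultimately have \<sigma>\<rho>: "integral {a..b} \<sigma> \<le> \<rho>"
    using lebesgue_integral_eq_integral[OF \<sigma>i] by simp
  have \<sigma>hk': "\<sigma> integrable_on {a..c}" by (rule integrable_on_subinterval[OF \<sigma>hk]) (use c in auto)
  have "integral {a..c} \<sigma> \<le> integral {a..b} \<sigma>"
    using \<sigma>0 \<sigma>hk \<sigma>hk' c by (intro integral_subset_le) auto
  have D': "(D' has_integral (y c - y a)) {a..c}"
    by (rule Lipschitz_along_curve_has_integral[OF ac c L lip negl]) (use vD in \<open>auto simp: D'_def\<close>)
  have "norm (integral {a..c} D') \<le> integral {a..c} (\<lambda>s. K * \<sigma> s)"
  proof (rule integral_norm_bound_integral)
    show "D' integrable_on {a..c}" using D' by blast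
    show "(\<lambda>s. K * \<sigma> s) integrable_on {a..c}" using integrable_on_cmult_left[OF \<sigma>hk', of K] by simp
    show "norm (D' s) \<le> K * \<sigma> s" if "s \<in> {a..c}" for s
    proof (cases "s \<in> N")
      case True then show ?thesis using K \<sigma>0 by (simp add: D'_def)
    next
      case False
      then have "s \<in> {a..b} - N" using that c by auto
      then show ?thesis using vD[of s] False by (simp add: D'_def \<sigma>_def X_def U_def horizontal_speed_def)
    qed
  qed
  also have "\<dots> = K * integral {a..c} \<sigma>" by simp
  also have "\<dots> \<le> K * \<rho>"
    using \<sigma>\<rho> \<open>integral {a..c} \<sigma> \<le> integral {a..b} \<sigma>\<close> K by (intro mult_left_mono) auto
  finally show ?thesis using D' by (simp add: integral_unique)
qed

lemma power_Lipschitz: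
  fixes R :: real
  assumes "0 \<le> R"
  shows "\<exists>L\<ge>0. \<forall>x y. \<bar>x\<bar> \<le> R \<longrightarrow> \<bar>y\<bar> \<le> R \<longrightarrow> \<bar>x ^ n - y ^ n\<bar> \<le> L * \<bar>x - y\<bar>"
proof (induction n)
  case (Suc n)
  then obtain L where L: "L \<ge> 0" "\<And>x y. \<bar>x\<bar> \<le> R \<Longrightarrow> \<bar>y\<bar> \<le> R \<Longrightarrow> \<bar>x ^ n - y ^ n\<bar> \<le> L * \<bar>x - y\<bar>" by blast
  have "\<bar>x ^ Suc n - y ^ Suc n\<bar> \<le> (R * L + R ^ n) * \<bar>x - y\<bar>" if "\<bar>x\<bar> \<le> R" "\<bar>y\<bar> \<le> R" for x y
  proof -
    have "\<bar>x ^ Suc n - y ^ Suc n\<bar> = \<bar>x * (x ^ n - y ^ n) + y ^ n * (x - y)\<bar>"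
      by (simp add: algebra_simps)
    also have "\<dots> \<le> \<bar>x\<bar> * \<bar>x ^ n - y ^ n\<bar> + \<bar>y\<bar> ^ n * \<bar>x - y\<bar>"
      by (metis abs_mult abs_triangle_ineq power_abs)
    also have "\<dots> \<le> R * (L * \<bar>x - y\<bar>) + R ^ n * \<bar>x - y\<bar>"
      using L that assms by (intro add_mono mult_mono power_mono) auto
    finally show ?thesis by (simp add: algebra_simps)
  qed
  then show ?case using L assms by (intro exI[of _ "R * L + R ^ n"]) auto
qed auto

lemma polynomial_sum_Lipschitz:
  fixes R :: real and c :: "'j \<Rightarrow> real" and e :: "'j \<Rightarrow> nat"
  assumes "0 \<le> R" "finite J"
  shows "\<exists>L\<ge>0. \<forall>x y. \<bar>x\<bar> \<le> R \<longrightarrow> \<bar>y\<bar> \<le> R \<longrightarrow>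
     \<bar>(\<Sum>j\<in>J. c j * x ^ e j) - (\<Sum>j\<in>J. c j * y ^ e j)\<bar> \<le> L * \<bar>x - y\<bar>"
  using assms(2)
proof (induction J rule: finite_induct)
  case (insert j J)
  then obtain L where L: "L \<ge> 0" "\<And>x y. \<bar>x\<bar> \<le> R \<Longrightarrow> \<bar>y\<bar> \<le> R \<Longrightarrow>
     \<bar>(\<Sum>j\<in>J. c j * x ^ e j) - (\<Sum>j\<in>J. c j * y ^ e j)\<bar> \<le> L * \<bar>x - y\<bar>" by blast
  obtain L' where L': "L' \<ge> 0" "\<And>x y. \<bar>x\<bar> \<le> R \<Longrightarrow> \<bar>y\<bar> \<le> R \<Longrightarrow> \<bar>x ^ e j - y ^ e j\<bar> \<le> L' * \<bar>x - y\<bar>"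
    using power_Lipschitz[OF assms(1), of "e j"] by blast
  have "\<bar>(\<Sum>j\<in>insert j J. c j * x ^ e j) - (\<Sum>j\<in>insert j J. c j * y ^ e j)\<bar> \<le> (\<bar>c j\<bar> * L' + L) * \<bar>x - y\<bar>"
    if "\<bar>x\<bar> \<le> R" "\<bar>y\<bar> \<le> R" for x y
  proof -
    have "(\<Sum>j\<in>insert j J. c j * x ^ e j) - (\<Sum>j\<in>insert j J. c j * y ^ e j)
        = c j * (x ^ e j - y ^ e j) + ((\<Sum>j\<in>J. c j * x ^ e j) - (\<Sum>j\<in>J. c j * y ^ e j))"
      using insert.hyps by (simp add: algebra_simps)
    also have "\<bar>\<dots>\<bar> \<le> \<bar>c j\<bar> * \<bar>x ^ e j - y ^ e j\<bar> + \<bar>(\<Sum>j\<in>J. c j * x ^ e j) - (\<Sum>j\<in>J. c j * y ^ e j)\<bar>"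
      by (rule order_trans[OF abs_triangle_ineq]) (simp add: abs_mult)
    also have "\<dots> \<le> \<bar>c j\<bar> * (L' * \<bar>x - y\<bar>) + L * \<bar>x - y\<bar>"
      using L L' that by (intro add_mono mult_left_mono) auto
    finally show ?thesis by (simp add: algebra_simps)
  qed
  then show ?case using L L' by (intro exI[of _ "\<bar>c j\<bar> * L' + L"]) auto
qed auto

lemma cc_dist_lessE:
  assumes "cc_dist k p q < ennreal \<rho>"
  obtains a b \<gamma> where "a \<le> b" "horizontal_curve k a b \<gamma>" "\<gamma> a = p" "\<gamma> b = q"
    "horizontal_length k a b \<gamma> < ennreal \<rho>"
  using assms unfolding cc_dist_def Inf_less_iff by blast

lemma increment_fst_horizontal_curve:
  assumes "horizontal_curve k a b \<gamma>" "horizontal_length k a b \<gamma> < ennreal \<rho>" "a \<le> c" "c \<le> b" "0 < \<rho>"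
  shows "\<bar>fst (\<gamma> c) - fst (\<gamma> a)\<bar> \<le> \<rho>"
proof -
  have "\<bar>fst (\<gamma> c) - fst (\<gamma> a)\<bar> \<le> 1 * \<rho>"
  proof (rule increment_along_horizontal_curve[OF assms(1-4), where L = 1 and y = "\<lambda>s. fst (\<gamma> s)"])
    fix s v assume "has_jet_velocity k a b \<gamma> v s"
    then show "\<exists>D. ((\<lambda>s. fst (\<gamma> s)) has_real_derivative D) (at s within {a..b}) \<and> \<bar>D\<bar> \<le> 1 * horizontal_speed k v"
      using horizontal_speed_ge(1)[of v k] by (auto simp: has_jet_velocity_def)
  qed (use assms(5) euclidean_jet_dist_ge(1) in simp_all)
  then show ?thesis by simp
qed

lemma cc_dist_fst_bound:
  assumes "cc_dist k p q < ennreal \<rho>" "0 < \<rho>"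
  shows "\<bar>fst p - fst q\<bar> \<le> \<rho>"
proof -
  obtain a b \<gamma> where "a \<le> b" "horizontal_curve k a b \<gamma>" "\<gamma> a = p" "\<gamma> b = q"
    "horizontal_length k a b \<gamma> < ennreal \<rho>" using cc_dist_lessE[OF assms(1)] .
  then show ?thesis using increment_fst_horizontal_curve[of k a b \<gamma> \<rho> b] assms(2)
    by (simp add: abs_minus_commute)
qed

text \<open>Taylor sums of a fixed jet \<open>c\<close> satisfy the same system \<open>u\<^sub>i' = x' * u\<^sub>i\<^sub>+\<^sub>1\<close> as
horizontal curves.\<close>

lemma taylor_sum_has_derivative:
  fixes c :: "nat \<Rightarrow> real"
  assumes "(x has_real_derivative x') (at s within S)" "i < k"
  shows "((\<lambda>r. \<Sum>j=i..k. c j * (x r ^ (j - i) / fact (j - i))) has_real_derivative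
      x' * (\<Sum>j=Suc i..k. c j * (x s ^ (j - Suc i) / fact (j - Suc i)))) (at s within S)"
proof -
  have "((\<lambda>r. c j * (x r ^ (j - i) / fact (j - i))) has_real_derivative
      x' * (c j * (x s ^ (j - Suc i) / fact (j - Suc i)))) (at s within S)" if "j \<in> {Suc i..k}" for j
  proof -
    from that have "Suc i \<le> j" by simp
    from le_Suc_ex[OF this] obtain m where j: "j = Suc (i + m)" by auto
    have "((\<lambda>r. c j / fact (Suc m) * x r ^ Suc m) has_real_derivative
        c j / fact (Suc m) * (of_nat (Suc m) * (x' * x s ^ (Suc m - Suc 0)))) (at s within S)"
      by (intro DERIV_cmult DERIV_power assms(1))
    moreover have "c j / fact (Suc m) * (of_nat (Suc m) * (x' * x s ^ (Suc m - Suc 0)))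
        = x' * (c j * (x s ^ m / fact m))"
      by (simp add: fact_Suc divide_simps del: of_nat_Suc)
    ultimately have "((\<lambda>r. c j / fact (Suc m) * x r ^ Suc m) has_real_derivative
        x' * (c j * (x s ^ m / fact m))) (at s within S)" by (rule DERIV_cong)
    then show ?thesis by (simp add: j)
  qed
  then have "((\<lambda>r. \<Sum>j=Suc i..k. c j * (x r ^ (j - i) / fact (j - i))) has_real_derivative
      (\<Sum>j=Suc i..k. x' * (c j * (x s ^ (j - Suc i) / fact (j - Suc i))))) (at s within S)"
    by (intro DERIV_sum) auto
  then have "((\<lambda>r. c i + (\<Sum>j=Suc i..k. c j * (x r ^ (j - i) / fact (j - i)))) has_real_derivative
      x' * (\<Sum>j=Suc i..k. c j * (x s ^ (j - Suc i) / fact (j - Suc i)))) (at s within S)"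
    using DERIV_add[OF DERIV_const[of "c i"]] by (simp add: sum_distrib_left)
  moreover have "(\<Sum>j=i..k. c j * (x r ^ (j - i) / fact (j - i)))
      = c i + (\<Sum>j=Suc i..k. c j * (x r ^ (j - i) / fact (j - i)))" for r
    using assms(2) by (subst sum.atLeast_Suc_atMost) auto
  ultimately show ?thesis by simp
qed

text \<open>The functions \<open>y i\<close> are the coordinates of the curve translated to start at the identity:
subtracting the Taylor sums of the starting jet \<open>p\<close> is left multiplication by its inverse. As
they satisfy \<open>y i' = x' * y (i + 1)\<close> and vanish at the start, downward induction on \<open>i\<close> bounds
them along the whole curve. At the end point \<open>x\<close> has returned to its initial value, where the
Taylor sum is just the coordinate of \<open>p\<close>.\<close>

lemma cc_dist_vertical_bound:
  assumes d: "cc_dist k p q < ennreal \<rho>" and \<rho>: "0 < \<rho>" and eq: "fst p = fst q" and i: "i \<le> k"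
  shows "\<bar>snd p i - snd q i\<bar> \<le> \<rho> ^ (k + 1 - i)"
proof -
  obtain a b \<gamma> where ab: "a \<le> b" and \<gamma>: "horizontal_curve k a b \<gamma>" and ends: "\<gamma> a = p" "\<gamma> b = q"
    and len: "horizontal_length k a b \<gamma> < ennreal \<rho>" using cc_dist_lessE[OF d] .
  define x where "x s = fst (\<gamma> s) - fst p" for s
  define T where "T i z = (\<Sum>j=i..k. snd p j * (z ^ (j - i) / fact (j - i)))" for i z
  define y where "y i s = snd (\<gamma> s) i - T i (x s)" for i s
  have x: "\<bar>x s\<bar> \<le> \<rho>" if "s \<in> {a..b}" for s
    using increment_fst_horizontal_curve[OF \<gamma> len _ _ \<rho>, of s] that by (simp add: x_def ends)
  have T0: "T i 0 = snd p i" if "i \<le> k" for i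
    unfolding T_def by (rule taylor_shift_zero[OF that])
  have lip: "\<exists>L\<ge>0. \<forall>s\<in>{a..b}. \<forall>s'\<in>{a..b}. \<bar>y i s - y i s'\<bar> \<le> L * euclidean_jet_dist k (\<gamma> s) (\<gamma> s')"
    if "i \<le> k" for i
  proof -
    obtain L where L: "L \<ge> 0" "\<And>z z'. \<bar>z\<bar> \<le> \<rho> \<Longrightarrow> \<bar>z'\<bar> \<le> \<rho> \<Longrightarrow> \<bar>T i z - T i z'\<bar> \<le> L * \<bar>z - z'\<bar>"
      using polynomial_sum_Lipschitz[of \<rho> "{i..k}" "\<lambda>j. snd p j / fact (j - i)" "\<lambda>j. j - i"] \<rho>
      unfolding T_def by (auto simp: mult.commute)
    have "\<bar>y i s - y i s'\<bar> \<le> (1 + L) * euclidean_jet_dist k (\<gamma> s) (\<gamma> s')" if "s \<in> {a..b}" "s' \<in> {a..b}" for s s'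
    proof -
      have "\<bar>y i s - y i s'\<bar> \<le> \<bar>snd (\<gamma> s) i - snd (\<gamma> s') i\<bar> + \<bar>T i (x s) - T i (x s')\<bar>"
        unfolding y_def by linarith
      also have "\<dots> \<le> euclidean_jet_dist k (\<gamma> s) (\<gamma> s') + L * euclidean_jet_dist k (\<gamma> s) (\<gamma> s')"
      proof (rule add_mono)
        show "\<bar>snd (\<gamma> s) i - snd (\<gamma> s') i\<bar> \<le> euclidean_jet_dist k (\<gamma> s) (\<gamma> s')"
          using \<open>i \<le> k\<close> by (rule euclidean_jet_dist_ge)
        have "\<bar>T i (x s) - T i (x s')\<bar> \<le> L * \<bar>x s - x s'\<bar>" using that x by (intro L) auto
        also have "\<dots> \<le> L * euclidean_jet_dist k (\<gamma> s) (\<gamma> s')"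
          using L(1) euclidean_jet_dist_ge(1)[of "\<gamma> s" "\<gamma> s'" k] by (intro mult_left_mono) (auto simp: x_def)
        finally show "\<bar>T i (x s) - T i (x s')\<bar> \<le> L * euclidean_jet_dist k (\<gamma> s) (\<gamma> s')" .
      qed
      finally show ?thesis by (simp add: algebra_simps)
    qed
    then show ?thesis using L(1) by (intro exI[of _ "1 + L"]) auto
  qed
  have "\<forall>c\<in>{a..b}. \<bar>y i c\<bar> \<le> \<rho> ^ (k + 1 - i)" using i
  proof (induction rule: inc_induct)
    case base
    obtain L where L: "0 \<le> L" "\<And>s s'. s \<in> {a..b} \<Longrightarrow> s' \<in> {a..b} \<Longrightarrow> \<bar>y k s - y k s'\<bar> \<le> L * euclidean_jet_dist k (\<gamma> s) (\<gamma> s')"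
      using lip[of k] by auto
    show ?case
    proof
      fix c assume c: "c \<in> {a..b}"
      have "\<bar>y k c - y k a\<bar> \<le> 1 * \<rho>"
      proof (rule increment_along_horizontal_curve[OF \<gamma> len _ _ L(1) _ \<rho> L(2)])
        fix s v assume "has_jet_velocity k a b \<gamma> v s"
        then have "((\<lambda>s. snd (\<gamma> s) k - snd p k) has_real_derivative snd v k) (at s within {a..b})"
          by (auto simp: has_jet_velocity_def intro!: derivative_eq_intros)
        moreover have "y k = (\<lambda>s. snd (\<gamma> s) k - snd p k)" by (auto simp: y_def T_def)
        ultimately show "\<exists>D. (y k has_real_derivative D) (at s within {a..b}) \<and> \<bar>D\<bar> \<le> 1 * horizontal_speed k v"
          using horizontal_speed_ge(2)[of v k] by auto
      qed (use c in auto)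
      moreover have "y k a = 0" by (simp add: y_def x_def ends T0)
      ultimately show "\<bar>y k c\<bar> \<le> \<rho> ^ (k + 1 - k)" by simp
    qed
  next
    case (step n)
    then have nk: "n < k" by simp
    obtain L where L: "0 \<le> L" "\<And>s s'. s \<in> {a..b} \<Longrightarrow> s' \<in> {a..b} \<Longrightarrow> \<bar>y n s - y n s'\<bar> \<le> L * euclidean_jet_dist k (\<gamma> s) (\<gamma> s')"
      using lip[of n] nk by auto
    show ?case
    proof
      fix c assume c: "c \<in> {a..b}"
      have "\<bar>y n c - y n a\<bar> \<le> \<rho> ^ (k - n) * \<rho>"
      proof (rule increment_along_horizontal_curve[OF \<gamma> len _ _ L(1) _ \<rho> L(2)])
        fix s v assume s: "s \<in> {a..b}" and v: "v \<in> horizontal_space k (\<gamma> s)" "has_jet_velocity k a b \<gamma> v s"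
        have "(x has_real_derivative fst v) (at s within {a..b})"
          using v(2) unfolding x_def by (auto simp: has_jet_velocity_def intro!: derivative_eq_intros)
        from taylor_sum_has_derivative[OF this nk, of "snd p"]
        have "((\<lambda>r. T n (x r)) has_real_derivative fst v * T (Suc n) (x s)) (at s within {a..b})"
          unfolding T_def .
        moreover have "((\<lambda>r. snd (\<gamma> r) n) has_real_derivative fst v * snd (\<gamma> s) (Suc n)) (at s within {a..b})"
          using v(2) nk unfolding has_jet_velocity_def horizontal_space_snd[OF v(1) nk, symmetric]
          by (meson less_imp_le)
        ultimately have "(y n has_real_derivative fst v * y (Suc n) s) (at s within {a..b})"
          unfolding y_def by (auto intro!: derivative_eq_intros simp: algebra_simps)
        moreover have "\<bar>fst v * y (Suc n) s\<bar> \<le> \<rho> ^ (k - n) * horizontal_speed k v"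
        proof -
          have "\<bar>y (Suc n) s\<bar> \<le> \<rho> ^ (k - n)" using step.IH s by auto
          then have "\<bar>fst v\<bar> * \<bar>y (Suc n) s\<bar> \<le> horizontal_speed k v * \<rho> ^ (k - n)"
            using horizontal_speed_ge(1)[of v k] by (intro mult_mono) auto
          then show ?thesis by (simp add: abs_mult mult.commute)
        qed
        ultimately show "\<exists>D. (y n has_real_derivative D) (at s within {a..b}) \<and> \<bar>D\<bar> \<le> \<rho> ^ (k - n) * horizontal_speed k v"
          by blast
      qed (use c \<rho> in auto)
      moreover have "y n a = 0" using nk by (simp add: y_def x_def ends T0)
      ultimately show "\<bar>y n c\<bar> \<le> \<rho> ^ (k + 1 - n)" using nk by (simp add: Suc_diff_le mult.commute)
    qed
  qed
  moreover have "y i b = snd q i - snd p i" using i eq by (simp add: y_def x_def ends T0)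
  moreover have "b \<in> {a..b}" using ab by simp
  ultimately have "\<bar>snd q i - snd p i\<bar> \<le> \<rho> ^ (k + 1 - i)" by metis
  then show ?thesis by (simp add: abs_minus_commute)
qed

section \<open>Upper bounds on the Carnot-Caratheodory distance\<close>

lemma continuous_derivative_imp_Lipschitz:
  fixes h h' :: "real \<Rightarrow> real"
  assumes "\<And>s. s \<in> {a..b} \<Longrightarrow> (h has_real_derivative h' s) (at s within {a..b})" "continuous_on {a..b} h'"
  shows "\<exists>L. L-lipschitz_on {a..b} h"
proof -
  have "bounded (h' ` {a..b})"
    using assms(2) by (intro compact_imp_bounded compact_continuous_image) auto
  then obtain L where L: "L > 0" "\<And>s. s \<in> {a..b} \<Longrightarrow> norm (h' s) \<le> L"
    unfolding bounded_pos by blast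
  have "L-lipschitz_on {a..b} h"
  proof (rule bounded_derivative_imp_lipschitz)
    fix s assume "s \<in> {a..b}"
    then show "(h has_derivative (*) (h' s)) (at s within {a..b})"
      using assms(1) by (simp add: has_field_derivative_def)
    show "onorm ((*) (h' s)) \<le> L"
      using L(2)[OF \<open>s \<in> {a..b}\<close>] by (intro onorm_bound) (use L in \<open>auto simp: abs_mult intro!: mult_right_mono\<close>)
  qed (use L in auto)
  then show ?thesis by blast
qed

lemma euclidean_jet_dist_le_sum:
  "euclidean_jet_dist k p q \<le> \<bar>fst p - fst q\<bar> + (\<Sum>i\<le>k. \<bar>snd p i - snd q i\<bar>)"
proof -
  have "euclidean_jet_dist k p q \<le> sqrt ((fst p - fst q)\<^sup>2) + sqrt (\<Sum>i\<le>k. (snd p i - snd q i)\<^sup>2)"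
    unfolding euclidean_jet_dist_def by (intro sqrt_add_le_add_sqrt) (auto simp: sum_nonneg)
  also have "sqrt (\<Sum>i\<le>k. (snd p i - snd q i)\<^sup>2) \<le> (\<Sum>i\<le>k. \<bar>snd p i - snd q i\<bar>)"
    using L2_set_le_sum_abs[of "\<lambda>i. snd p i - snd q i" "{..k}"] by (simp add: L2_set_def)
  finally show ?thesis by simp
qed

lemma abs_continuous_if_Lipschitz:
  assumes x: "\<exists>L. L-lipschitz_on {a..b} (\<lambda>s. fst (\<gamma> s))"
    and u: "\<And>i. i \<le> k \<Longrightarrow> \<exists>L. L-lipschitz_on {a..b} (\<lambda>s. snd (\<gamma> s) i)"
  shows "abs_continuous_jet_curve k a b \<gamma>"
  unfolding abs_continuous_jet_curve_def
proof (intro allI impI)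
  fix e :: real assume e: "e > 0"
  obtain Lx where Lx: "Lx-lipschitz_on {a..b} (\<lambda>s. fst (\<gamma> s))" using x by blast
  have "\<forall>i. \<exists>L. i \<le> k \<longrightarrow> L-lipschitz_on {a..b} (\<lambda>s. snd (\<gamma> s) i)" using u by blast
  then obtain Lu where Lu: "\<And>i. i \<le> k \<Longrightarrow> (Lu i)-lipschitz_on {a..b} (\<lambda>s. snd (\<gamma> s) i)" by metis
  define M where "M = Lx + (\<Sum>i\<le>k. Lu i)"
  have M: "0 \<le> M" unfolding M_def
    using lipschitz_on_nonneg[OF Lx] lipschitz_on_nonneg[OF Lu] by (auto intro!: add_nonneg_nonneg sum_nonneg)
  have lip: "euclidean_jet_dist k (\<gamma> s) (\<gamma> s') \<le> M * \<bar>s - s'\<bar>" if "s \<in> {a..b}" "s' \<in> {a..b}" for s s'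
  proof -
    have "euclidean_jet_dist k (\<gamma> s) (\<gamma> s') \<le> Lx * \<bar>s - s'\<bar> + (\<Sum>i\<le>k. Lu i * \<bar>s - s'\<bar>)"
    proof (rule order_trans[OF euclidean_jet_dist_le_sum add_mono])
      show "\<bar>fst (\<gamma> s) - fst (\<gamma> s')\<bar> \<le> Lx * \<bar>s - s'\<bar>"
        using lipschitz_onD[OF Lx that] by (simp add: dist_real_def)
      show "(\<Sum>i\<le>k. \<bar>snd (\<gamma> s) i - snd (\<gamma> s') i\<bar>) \<le> (\<Sum>i\<le>k. Lu i * \<bar>s - s'\<bar>)"
        using lipschitz_onD[OF Lu that] by (intro sum_mono) (simp add: dist_real_def)
    qed
    then show ?thesis by (simp add: M_def sum_distrib_right distrib_right)
  qed
  show "\<exists>\<delta>>0. \<forall>D. D division_of \<Union>D \<and> \<Union>D \<subseteq> {a..b} \<and> (\<Sum>K\<in>D. Sup K - Inf K) < \<delta> \<longrightarrow>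
          (\<Sum>K\<in>D. euclidean_jet_dist k (\<gamma> (Inf K)) (\<gamma> (Sup K))) < e"
  proof (intro exI[of _ "e / (M + 1)"] conjI allI impI)
    show "0 < e / (M + 1)" using e M by simp
    fix D :: "real set set"
    assume D: "D division_of \<Union>D \<and> \<Union>D \<subseteq> {a..b} \<and> (\<Sum>K\<in>D. Sup K - Inf K) < e / (M + 1)"
    have "(\<Sum>K\<in>D. euclidean_jet_dist k (\<gamma> (Inf K)) (\<gamma> (Sup K))) \<le> (\<Sum>K\<in>D. M * (Sup K - Inf K))"
    proof (rule sum_mono)
      fix K assume K: "K \<in> D"
      obtain u v where uv: "K = cbox u v" "K \<noteq> {}"
        using division_ofD(3,4)[of D "\<Union>D" K] D K by blast
      then have le: "u \<le> v" by auto
      then have ends: "Inf K = u" "Sup K = v" and "u \<in> K" "v \<in> K" using uv by auto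
      moreover have "K \<subseteq> {a..b}" using D K by blast
      ultimately have "u \<in> {a..b}" "v \<in> {a..b}" by blast+
      from lip[OF this] show "euclidean_jet_dist k (\<gamma> (Inf K)) (\<gamma> (Sup K)) \<le> M * (Sup K - Inf K)"
        unfolding ends using le by simp
    qed
    also have "\<dots> = M * (\<Sum>K\<in>D. Sup K - Inf K)" by (simp add: sum_distrib_left)
    also have "\<dots> \<le> M * (e / (M + 1))" using D M by (intro mult_left_mono) auto
    also have "\<dots> < e" using M e by (simp add: field_simps)
    finally show "(\<Sum>K\<in>D. euclidean_jet_dist k (\<gamma> (Inf K)) (\<gamma> (Sup K))) < e" .
  qed
qed

text \<open>A finite exceptional set accommodates curves with corners, so that concatenation of
curves does not need to be treated.\<close>

lemma cc_dist_le_if_piecewise_smooth: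
  assumes T: "0 < T" and jet: "\<gamma> ` {0..T} \<subseteq> jet_space k"
    and x: "\<exists>L. L-lipschitz_on {0..T} (\<lambda>s. fst (\<gamma> s))"
    and u: "\<And>i. i \<le> k \<Longrightarrow> \<exists>L. L-lipschitz_on {0..T} (\<lambda>s. snd (\<gamma> s) i)"
    and F: "finite F"
    and vel: "\<And>s. s \<in> {0..T} - F \<Longrightarrow>
        \<exists>v\<in>horizontal_space k (\<gamma> s). has_jet_velocity k 0 T \<gamma> v s \<and> horizontal_speed k v \<le> B"
    and B: "0 \<le> B"
  shows "cc_dist k (\<gamma> 0) (\<gamma> T) \<le> ennreal (B * T)"
proof -
  have "F \<in> null_sets lebesgue" using F by (simp add: negligible_iff_null_sets[symmetric] negligible_finite)
  then have "AE s in lebesgue. s \<notin> F" by (rule AE_not_in)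
  then have AEF: "AE s in lebesgue_on {0..T}. s \<in> {0..T} - F"
    by (auto simp: AE_restrict_space_iff elim: eventually_mono)
  have "AE s in lebesgue_on {0..T}. \<exists>v\<in>horizontal_space k (\<gamma> s). has_jet_velocity k 0 T \<gamma> v s"
    using AEF by eventually_elim (use vel in blast)
  then have "horizontal_curve k 0 T \<gamma>"
    unfolding horizontal_curve_def using jet abs_continuous_if_Lipschitz[OF x u] by blast
  then have "cc_dist k (\<gamma> 0) (\<gamma> T) \<le> horizontal_length k 0 T \<gamma>"
    unfolding cc_dist_def using less_imp_le[OF T] by (intro Inf_lower) blast
  also have "\<dots> \<le> (\<integral>\<^sup>+s. ennreal B \<partial>lebesgue_on {0..T})"
    unfolding horizontal_length_def
  proof (rule nn_integral_mono_AE, use AEF in eventually_elim)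
    case (elim s)
    then obtain v where v: "has_jet_velocity k 0 T \<gamma> v s" "horizontal_speed k v \<le> B" using vel by blast
    have "vector_derivative (\<lambda>r. fst (\<gamma> r)) (at s within {0..T}) = fst v"
      "vector_derivative (\<lambda>r. snd (\<gamma> r) k) (at s within {0..T}) = snd v k"
      using elim v(1) T unfolding has_jet_velocity_def
      by (auto intro!: vector_derivative_within_closed_interval simp: has_real_derivative_iff_has_vector_derivative)
    then show ?case using v(2) by (auto simp: horizontal_speed_def intro!: ennreal_leI)
  qed
  also have "\<dots> = ennreal (B * T)"
    using T B by (simp add: emeasure_restrict_space ennreal_mult)
  finally show ?thesis .
qed

lemma horizontal_speed_le: "horizontal_speed k v \<le> \<bar>fst v\<bar> + \<bar>snd v k\<bar>"
  unfolding horizontal_speed_def by (rule sqrt_sum_squares_le_sum_abs)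

lemma frame_comb_simps:
  "fst (frame_comb k p a b) = a"
  "snd (frame_comb k p a b) i = (if i < k then a * snd p (Suc i) else if i = k then b else 0)"
  by (auto simp: frame_comb_def frame_X_def frame_U_def)

lemma frame_comb_horizontal: "frame_comb k p a b \<in> horizontal_space k p"
  by (auto simp: horizontal_space_def)

text \<open>The jet curve itself joins the two points, and \<open>f\<close> has a bounded derivative of order \<open>k +
1\<close> on compact intervals. The affine parametrisation over the unit interval serves both orders
of \<open>x\<close> and \<open>y\<close>.\<close>

lemma cc_dist_jet_of_le:
  assumes f: "smooth_real f"
  shows "\<exists>C>0. \<forall>x y. \<bar>x\<bar> \<le> R \<longrightarrow> \<bar>y\<bar> \<le> R \<longrightarrow> cc_dist k (jet_of k f x) (jet_of k f y) \<le> ennreal (C * \<bar>x - y\<bar>)"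
proof -
  have der: "((deriv ^^ n) f has_real_derivative (deriv ^^ Suc n) f z) (at z)" for n z
    using f by (auto simp: smooth_real_def DERIV_deriv_iff_real_differentiable)
  then have cont: "continuous_on A ((deriv ^^ n) f)" for n A
    by (meson DERIV_isCont continuous_at_imp_continuous_on)
  have "bounded ((deriv ^^ Suc k) f ` {-R..R})"
    by (intro compact_imp_bounded compact_continuous_image cont compact_Icc)
  then obtain M where M: "M > 0" "\<And>z. z \<in> {-R..R} \<Longrightarrow> norm ((deriv ^^ Suc k) f z) \<le> M"
    unfolding bounded_pos by blast
  show ?thesis
  proof (intro exI[of _ "1 + M"] conjI allI impI)
    show "0 < 1 + M" using M by simp
    fix x y assume xy: "\<bar>x\<bar> \<le> R" "\<bar>y\<bar> \<le> R"
    define z where "z s = x + (y - x) * s" for s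
    have zR: "z s \<in> {-R..R}" if "s \<in> {0..1}" for s
    proof -
      have "z s = (1 - s) * x + s * y" by (simp add: z_def algebra_simps)
      moreover have "\<bar>(1 - s) * x + s * y\<bar> \<le> (1 - s) * R + s * R"
        using that xy by (intro order_trans[OF abs_triangle_ineq] add_mono) (auto simp: abs_mult intro!: mult_left_mono)
      ultimately show ?thesis by (auto simp: abs_le_iff algebra_simps)
    qed
    have zd: "(z has_real_derivative (y - x)) (at s within A)" for s A
      unfolding z_def by (auto intro!: derivative_eq_intros)
    have fd: "((\<lambda>s. (deriv ^^ n) f (z s)) has_real_derivative (y - x) * (deriv ^^ Suc n) f (z s)) (at s within A)" for n s A
      using DERIV_chain2[OF der zd] by (simp add: mult.commute)
    define \<gamma> where "\<gamma> s = jet_of k f (z s)" for s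
    have snd\<gamma>: "(\<lambda>s. snd (\<gamma> s) i) = (\<lambda>s. (deriv ^^ i) f (z s))" if "i \<le> k" for i
      using that by (auto simp: \<gamma>_def jet_of_def)
    have fst\<gamma>: "(\<lambda>s. fst (\<gamma> s)) = z" by (auto simp: \<gamma>_def jet_of_def)
    have zc: "continuous_on A z" for A unfolding z_def by (intro continuous_intros)
    have "cc_dist k (\<gamma> 0) (\<gamma> 1) \<le> ennreal (((1 + M) * \<bar>x - y\<bar>) * 1)"
    proof (rule cc_dist_le_if_piecewise_smooth[where F = "{}"])
      show "\<gamma> ` {0..1} \<subseteq> jet_space k" using jet_of_in_jet_space by (auto simp: \<gamma>_def)
      show "\<exists>L. L-lipschitz_on {0..1} (\<lambda>s. fst (\<gamma> s))"
        unfolding fst\<gamma> using zd by (rule continuous_derivative_imp_Lipschitz) auto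
      show "\<exists>L. L-lipschitz_on {0..1} (\<lambda>s. snd (\<gamma> s) i)" if "i \<le> k" for i
        unfolding snd\<gamma>[OF that]
        by (rule continuous_derivative_imp_Lipschitz[OF fd])
           (intro continuous_intros continuous_on_compose2[OF cont[of UNIV] zc subset_UNIV])
      show "\<exists>v\<in>horizontal_space k (\<gamma> s). has_jet_velocity k 0 1 \<gamma> v s \<and> horizontal_speed k v \<le> (1 + M) * \<bar>x - y\<bar>"
        if s: "s \<in> {0..1} - {}" for s
      proof (intro bexI conjI)
        let ?v = "frame_comb k (\<gamma> s) (y - x) ((y - x) * (deriv ^^ Suc k) f (z s))"
        show "?v \<in> horizontal_space k (\<gamma> s)" by (rule frame_comb_horizontal)
        have "snd ?v i = (y - x) * (deriv ^^ Suc i) f (z s)" if "i \<le> k" for i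
          using that by (auto simp: frame_comb_simps \<gamma>_def jet_of_def)
        then show "has_jet_velocity k 0 1 \<gamma> ?v s"
          using fd zd by (simp add: has_jet_velocity_def fst\<gamma> snd\<gamma> frame_comb_simps(1))
        have "\<bar>(y - x) * (deriv ^^ Suc k) f (z s)\<bar> \<le> \<bar>y - x\<bar> * M"
          using M(2)[OF zR] s unfolding abs_mult by (intro mult_left_mono) auto
        then show "horizontal_speed k ?v \<le> (1 + M) * \<bar>x - y\<bar>"
          by (intro order_trans[OF horizontal_speed_le]) (simp add: frame_comb_simps algebra_simps abs_minus_commute)
      qed
    qed (use M in auto)
    moreover have "\<gamma> 0 = jet_of k f x" "\<gamma> 1 = jet_of k f y" by (auto simp: \<gamma>_def z_def)
    ultimately show "cc_dist k (jet_of k f x) (jet_of k f y) \<le> ennreal ((1 + M) * \<bar>x - y\<bar>)" by simp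
  qed
qed

lemma poly_higher_pderiv_at_zero:
  fixes p :: "real poly"
  shows "poly ((pderiv ^^ j) p) 0 = fact j * coeff p j"
  by (simp add: poly_0_coeff_0 coeff_higher_pderiv pochhammer_fact)

lemma poly_higher_pderiv_eq_zero:
  fixes p :: "real poly"
  assumes "[:-a, 1:] ^ n dvd p" "j < n"
  shows "poly ((pderiv ^^ j) p) a = 0"
  using assms
proof (induction j arbitrary: p n)
  case 0
  then have "[:-a, 1:] dvd p" by (metis dvd_power dvd_trans)
  then show ?case by (simp add: poly_eq_0_iff_dvd)
next
  case (Suc j)
  then obtain m where n: "n = Suc m" "j < m" by (cases n) auto
  from Suc.prems(1) obtain r where r: "p = [:-a, 1:] ^ Suc m * r" unfolding n by (elim dvdE)
  have "pderiv p = [:-a, 1:] ^ m * ([:-a, 1:] * pderiv r + smult (of_nat (Suc m)) (r * pderiv [:-a, 1:]))"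
    unfolding r pderiv_mult pderiv_power_Suc by (simp add: algebra_simps del: of_nat_Suc)
  then have "[:-a, 1:] ^ m dvd pderiv p" by simp
  then have "poly ((pderiv ^^ j) (pderiv p)) a = 0" using n(2) by (rule Suc.IH)
  then show ?case by (simp only: funpow_Suc_right o_apply)
qed

text \<open>The cutoff \<open>H\<close> equals \<open>(1 - X ^ (k + 1)) ^ (k + 1)\<close>. It is 1 to order \<open>k\<close> at 0 and
vanishes to order \<open>k\<close> at 1, so that \<open>H * X ^ i / i!\<close> has the required jets.\<close>

lemma exists_Hermite_basis:
  "\<exists>b :: nat \<Rightarrow> real poly.
     (\<forall>i\<le>k. \<forall>j\<le>k. poly ((pderiv ^^ j) (b i)) 0 = (if i = j then 1 else 0)) \<and>
     (\<forall>i\<le>k. \<forall>j\<le>k. poly ((pderiv ^^ j) (b i)) 1 = 0)"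
proof -
  define H :: "real poly" where "H = (1 - monom 1 (Suc k)) ^ Suc k"
  define b where "b i = monom (1 / fact i) i * H" for i :: nat
  have "monom 1 (Suc k) dvd 1 ^ Suc k - (1 - monom (1::real) (Suc k)) ^ Suc k"
    using diff_power_eq_sum[of "1 :: real poly" k "1 - monom 1 (Suc k)"] by simp
  then obtain q where q: "1 - H = monom 1 (Suc k) * q" unfolding H_def by (auto elim: dvdE)
  have H: "coeff H m = (if m = 0 then 1 else 0)" if "m \<le> k" for m
  proof -
    have "coeff (1 - H) m = 0" unfolding q using that by (simp add: coeff_monom_mult)
    then show ?thesis by (auto simp: coeff_1 split: if_splits)
  qed
  have "[:-1, 1:] dvd 1 - monom (1::real) (Suc k)"
    by (simp add: poly_eq_0_iff_dvd[symmetric] poly_monom)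
  then have "[:-1, 1:] ^ Suc k dvd H" unfolding H_def by (rule dvd_power_same)
  then have "[:-1, 1:] ^ Suc k dvd b i" for i unfolding b_def by (rule dvd_mult)
  then have 1: "poly ((pderiv ^^ j) (b i)) 1 = 0" if "j \<le> k" for i j
    using poly_higher_pderiv_eq_zero[of 1 "Suc k" "b i" j] that by simp
  have 0: "poly ((pderiv ^^ j) (b i)) 0 = (if i = j then 1 else 0)" if "j \<le> k" for i j
    using that H[of "j - i"] H[of 0] by (simp add: poly_higher_pderiv_at_zero b_def coeff_monom_mult)
  show ?thesis by (intro exI[of _ b] conjI allI impI 0 1)
qed

lemma poly_Lipschitz: "\<exists>L. L-lipschitz_on {a..b} (poly p)" for p :: "real poly"
  by (rule continuous_derivative_imp_Lipschitz[where h' = "poly (pderiv p)"])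
     (auto intro!: continuous_intros has_field_derivative_at_within poly_DERIV)

text \<open>The curve goes from \<open>x = t\<close> to \<open>x = t + \<rho>\<close> during the time interval \<open>[0, 1]\<close> and back
during \<open>[1, 2]\<close>. The way back follows the jets of the polynomial of degree \<open>k\<close> whose jet at \<open>t\<close>
is \<open>v\<close>; \<open>T i\<close> is its \<open>i\<close>-th derivative. On the way out the function \<open>\<rho> ^ (k + 1) * \<phi> ((x - t) /
\<rho>)\<close> is subtracted, where \<open>\<phi>\<close> has jet \<open>\<omega>\<close>, the rescaled difference \<open>v - u\<close>, at 0 and a vanishing
jet at 1. This makes the curve start at \<open>u\<close> and close up at the turning point. The rescaled
coefficients \<open>\<omega> i\<close> are at most 1 in absolute value, so the derivative of \<open>\<phi>\<close> of order \<open>k + 1\<close>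
is bounded independently of \<open>\<rho>\<close>, and with it the speed divided by \<open>\<rho>\<close>.\<close>

lemma cc_dist_vertical_le:
  "\<exists>C>0. \<forall>t u v \<rho>. (\<forall>i>k. u i = 0 \<and> v i = 0) \<longrightarrow> 0 < \<rho> \<longrightarrow> (\<forall>i\<le>k. \<bar>u i - v i\<bar> \<le> \<rho> ^ (k + 1 - i)) \<longrightarrow>
     cc_dist k (t, u) (t, v) \<le> ennreal (C * \<rho>)"
proof -
  obtain b :: "nat \<Rightarrow> real poly" where
    b0: "\<And>i j. i \<le> k \<Longrightarrow> j \<le> k \<Longrightarrow> poly ((pderiv ^^ j) (b i)) 0 = (if i = j then 1 else 0)" and
    b1: "\<And>i j. i \<le> k \<Longrightarrow> j \<le> k \<Longrightarrow> poly ((pderiv ^^ j) (b i)) 1 = 0"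
    using exists_Hermite_basis[of k] by blast
  have "\<exists>M>0. \<forall>s\<in>{0..1}. \<bar>poly ((pderiv ^^ Suc k) (b i)) s\<bar> \<le> M" for i
  proof -
    have "bounded (poly ((pderiv ^^ Suc k) (b i)) ` {0..1})"
      by (intro compact_imp_bounded compact_continuous_image continuous_on_poly continuous_on_id compact_Icc)
    then show ?thesis unfolding bounded_pos by auto
  qed
  then obtain M where M: "\<And>i. M i > 0" "\<And>i s. s \<in> {0..1} \<Longrightarrow> \<bar>poly ((pderiv ^^ Suc k) (b i)) s\<bar> \<le> M i"
    by metis
  define C where "C = (\<Sum>i\<le>k. M i)"
  have C: "0 \<le> C" unfolding C_def using M(1) by (intro sum_nonneg) (simp add: less_imp_le)
  show ?thesis
  proof (intro exI[of _ "2 * (1 + C)"] conjI allI impI)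
    show "0 < 2 * (1 + C)" using C by simp
    fix t \<rho> :: real and u v :: "nat \<Rightarrow> real"
    assume uv0: "\<forall>i>k. u i = 0 \<and> v i = 0" and \<rho>: "0 < \<rho>" and uv: "\<forall>i\<le>k. \<bar>u i - v i\<bar> \<le> \<rho> ^ (k + 1 - i)"
    define \<omega> where "\<omega> i = (v i - u i) / \<rho> ^ (k + 1 - i)" for i
    have \<omega>: "\<bar>\<omega> i\<bar> \<le> 1" if "i \<le> k" for i
      using uv that \<rho> by (simp add: \<omega>_def abs_minus_commute)
    define \<phi> where "\<phi> = (\<Sum>i\<le>k. smult (\<omega> i) (b i))"
    have \<phi>: "poly ((pderiv ^^ j) \<phi>) s = (\<Sum>i\<le>k. \<omega> i * poly ((pderiv ^^ j) (b i)) s)" for j s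
      by (simp add: \<phi>_def higher_pderiv_sum higher_pderiv_smult poly_sum)
    have \<phi>0: "poly ((pderiv ^^ j) \<phi>) 0 = \<omega> j" if "j \<le> k" for j
    proof -
      have "poly ((pderiv ^^ j) \<phi>) 0 = (\<Sum>i\<le>k. if i = j then \<omega> i else 0)"
        unfolding \<phi> using b0 that by (intro sum.cong) auto
      then show ?thesis using that by simp
    qed
    have \<phi>1: "poly ((pderiv ^^ j) \<phi>) 1 = 0" if "j \<le> k" for j
      unfolding \<phi> using b1 that by simp
    have \<phi>C: "\<bar>poly ((pderiv ^^ Suc k) \<phi>) s\<bar> \<le> C" if "s \<in> {0..1}" for s
    proof -
      have "\<bar>poly ((pderiv ^^ Suc k) \<phi>) s\<bar> \<le> (\<Sum>i\<le>k. \<bar>\<omega> i * poly ((pderiv ^^ Suc k) (b i)) s\<bar>)"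
        unfolding \<phi> by (rule sum_abs)
      also have "\<dots> \<le> (\<Sum>i\<le>k. 1 * M i)"
        unfolding abs_mult using \<omega> M(2)[OF that] by (intro sum_mono mult_mono) auto
      finally show ?thesis by (simp add: C_def)
    qed
    define T where "T i z = (\<Sum>j=i..k. v j * (z ^ (j - i) / fact (j - i)))" for i z
    define A where "A s = (if s \<le> 1 then s else 2 - s)" for s :: real
    define g where "g i s = (if s \<le> 1 then poly ((pderiv ^^ i) \<phi>) s else 0)" for i s
    define \<gamma> where "\<gamma> s = (t + \<rho> * A s, \<lambda>i. if i \<le> k then T i (\<rho> * A s) - \<rho> ^ (k + 1 - i) * g i s else 0)" for s
    have fst\<gamma>: "(\<lambda>s. fst (\<gamma> s)) = (\<lambda>s. t + \<rho> * A s)" by (simp add: \<gamma>_def)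
    have snd\<gamma>: "(\<lambda>s. snd (\<gamma> s) i) = (\<lambda>s. T i (\<rho> * A s) - \<rho> ^ (k + 1 - i) * g i s)" if "i \<le> k" for i
      using that by (simp add: \<gamma>_def)
    have Alip: "\<bar>A s - A s'\<bar> \<le> \<bar>s - s'\<bar>" for s s' by (auto simp: A_def)
    have A01: "0 \<le> A s \<and> A s \<le> 1" if "s \<in> {0..2}" for s using that by (auto simp: A_def)
    have "cc_dist k (\<gamma> 0) (\<gamma> 2) \<le> ennreal ((\<rho> * (1 + C)) * 2)"
    proof (rule cc_dist_le_if_piecewise_smooth[where F = "{1}"])
      show "\<gamma> ` {0..2} \<subseteq> jet_space k" by (auto simp: \<gamma>_def jet_space_def)
      have "\<rho>-lipschitz_on {0..2} (\<lambda>s. t + \<rho> * A s)"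
        using \<rho> Alip by (intro lipschitz_onI) (auto simp: dist_real_def abs_mult right_diff_distrib[symmetric])
      then show "\<exists>L. L-lipschitz_on {0..2} (\<lambda>s. fst (\<gamma> s))" unfolding fst\<gamma> by blast
      show "\<exists>L. L-lipschitz_on {0..2} (\<lambda>s. snd (\<gamma> s) i)" if i: "i \<le> k" for i
      proof -
        obtain L where L: "L \<ge> 0" "\<And>z z'. \<bar>z\<bar> \<le> \<rho> \<Longrightarrow> \<bar>z'\<bar> \<le> \<rho> \<Longrightarrow> \<bar>T i z - T i z'\<bar> \<le> L * \<bar>z - z'\<bar>"
          using polynomial_sum_Lipschitz[of \<rho> "{i..k}" "\<lambda>j. v j / fact (j - i)" "\<lambda>j. j - i"] \<rho>
          unfolding T_def by (auto simp: mult.commute)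
        have "(L * \<rho>)-lipschitz_on {0..2} (\<lambda>s. T i (\<rho> * A s))"
        proof (rule lipschitz_onI)
          fix s s' :: real assume s: "s \<in> {0..2}" "s' \<in> {0..2}"
          have "\<bar>\<rho> * A s\<bar> \<le> \<rho>" "\<bar>\<rho> * A s'\<bar> \<le> \<rho>" using A01[OF s(1)] A01[OF s(2)] \<rho> by (auto simp: abs_mult)
          then have "\<bar>T i (\<rho> * A s) - T i (\<rho> * A s')\<bar> \<le> L * \<bar>\<rho> * A s - \<rho> * A s'\<bar>" by (rule L(2))
          also have "\<dots> = L * \<rho> * \<bar>A s - A s'\<bar>"
            using \<rho> by (simp add: abs_mult right_diff_distrib[symmetric])
          also have "\<dots> \<le> L * \<rho> * \<bar>s - s'\<bar>" using Alip L(1) \<rho> by (intro mult_left_mono) auto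
          finally show "dist (T i (\<rho> * A s)) (T i (\<rho> * A s')) \<le> L * \<rho> * dist s s'" by (simp add: dist_real_def)
        qed (use L \<rho> in simp)
        moreover obtain L' where "L'-lipschitz_on {0..1} (poly ((pderiv ^^ i) \<phi>))" using poly_Lipschitz by blast
        then have "(max L' 0)-lipschitz_on {0..2} (g i)"
          unfolding g_def by (intro lipschitz_on_concat_max lipschitz_on_constant) (use \<phi>1[OF i] in auto)
        ultimately show ?thesis
          unfolding snd\<gamma>[OF i] by (intro exI) (rule lipschitz_on_diff lipschitz_on_cmult_real | assumption)+
      qed
      show "\<exists>v\<in>horizontal_space k (\<gamma> s). has_jet_velocity k 0 2 \<gamma> v s \<and> horizontal_speed k v \<le> \<rho> * (1 + C)"
        if s: "s \<in> {0..2} - {1}" for s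
      proof -
        define \<epsilon> where "\<epsilon> = (if s < 1 then 1 else -1 :: real)"
        have dA: "(A has_real_derivative \<epsilon>) (at s within {0..2})"
        proof (cases "s < 1")
          case True
          have "(A has_real_derivative 1) (at s)"
            by (rule has_field_derivative_transform_within_open[of "\<lambda>s. s" _ _ "{..<1}"])
               (use True in \<open>auto simp: A_def\<close>)
          then show ?thesis using True by (simp add: \<epsilon>_def has_field_derivative_at_within)
        next
          case False
          then have "1 < s" using s by auto
          have "((\<lambda>s. 2 - s) has_real_derivative -1) (at s)" by (auto intro!: derivative_eq_intros)
          then have "(A has_real_derivative -1) (at s)"
            by (rule has_field_derivative_transform_within_open[of _ _ _ "{1<..}"])
               (use \<open>1 < s\<close> in \<open>auto simp: A_def\<close>)
          then show ?thesis using False by (simp add: \<epsilon>_def has_field_derivative_at_within)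
        qed
        have dg: "(g i has_real_derivative g (Suc i) s) (at s within {0..2})" for i
        proof (cases "s < 1")
          case True
          have "(poly ((pderiv ^^ i) \<phi>) has_real_derivative g (Suc i) s) (at s)"
            using poly_DERIV[of "(pderiv ^^ i) \<phi>" s] True by (simp add: g_def)
          then have "(g i has_real_derivative g (Suc i) s) (at s)"
            by (rule has_field_derivative_transform_within_open[of _ _ _ "{..<1}"])
               (use True in \<open>auto simp: g_def\<close>)
          then show ?thesis by (rule has_field_derivative_at_within)
        next
          case False
          then have "1 < s" using s by auto
          then have "((\<lambda>s. 0) has_real_derivative g (Suc i) s) (at s)" by (simp add: g_def)
          then have "(g i has_real_derivative g (Suc i) s) (at s)"
            by (rule has_field_derivative_transform_within_open[of _ _ _ "{1<..}"])
               (use \<open>1 < s\<close> in \<open>auto simp: g_def\<close>)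
          then show ?thesis by (rule has_field_derivative_at_within)
        qed
        \<comment> \<open>The sign only differs from 1 on the way back, where \<open>g\<close> is 0.\<close>
        have \<epsilon>g: "\<epsilon> * g i s = g i s" for i using s by (auto simp: \<epsilon>_def g_def)
        have dA': "((\<lambda>s. \<rho> * A s) has_real_derivative \<rho> * \<epsilon>) (at s within {0..2})"
          using DERIV_cmult[OF dA] by simp
        let ?v = "frame_comb k (\<gamma> s) (\<rho> * \<epsilon>) (- (\<rho> * g (Suc k) s))"
        have "((\<lambda>s. snd (\<gamma> s) i) has_real_derivative snd ?v i) (at s within {0..2})" if "i \<le> k" for i
        proof (cases "i = k")
          case True
          \<comment> \<open>The polynomial has degree \<open>k\<close>, so only \<open>\<phi>\<close> contributes to the derivative of \<open>u\<^sub>k\<close>.\<close>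
          have "T k = (\<lambda>_. v k)" by (auto simp: T_def)
          then have "(\<lambda>s. snd (\<gamma> s) k) = (\<lambda>s. v k - \<rho> * g k s)" by (simp add: snd\<gamma>)
          moreover have "((\<lambda>s. v k - \<rho> * g k s) has_real_derivative - (\<rho> * g (Suc k) s)) (at s within {0..2})"
            using dg[of k] by (auto intro!: derivative_eq_intros)
          ultimately show ?thesis unfolding True by (simp add: frame_comb_simps)
        next
          case False
          then have ik: "i < k" using that by simp
          have "((\<lambda>s. T i (\<rho> * A s)) has_real_derivative \<rho> * \<epsilon> * T (Suc i) (\<rho> * A s)) (at s within {0..2})"
            unfolding T_def by (rule taylor_sum_has_derivative[OF dA' ik])
          then have "((\<lambda>s. T i (\<rho> * A s) - \<rho> ^ (k + 1 - i) * g i s) has_real_derivative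
              \<rho> * \<epsilon> * T (Suc i) (\<rho> * A s) - \<rho> ^ (k + 1 - i) * g (Suc i) s) (at s within {0..2})"
            by (intro DERIV_diff DERIV_cmult dg)
          moreover have "snd ?v i = \<rho> * \<epsilon> * T (Suc i) (\<rho> * A s) - \<rho> ^ (k + 1 - i) * g (Suc i) s"
          proof -
            have "\<rho> ^ (k + 1 - i) = \<rho> * \<rho> ^ (k - i)" using ik by (simp add: Suc_diff_le)
            moreover have "\<rho> * \<epsilon> * (\<rho> ^ (k - i) * g (Suc i) s) = \<rho> * \<rho> ^ (k - i) * (\<epsilon> * g (Suc i) s)"
              by (simp add: mult_ac)
            ultimately show ?thesis using ik
              by (simp add: frame_comb_simps \<gamma>_def right_diff_distrib \<epsilon>g)
          qed
          ultimately show ?thesis using snd\<gamma>[OF that] by simp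
        qed
        moreover have "((\<lambda>s. fst (\<gamma> s)) has_real_derivative fst ?v) (at s within {0..2})"
          unfolding fst\<gamma> frame_comb_simps using DERIV_add[OF DERIV_const[of t] dA'] by simp
        ultimately have "has_jet_velocity k 0 2 \<gamma> ?v s" by (simp add: has_jet_velocity_def)
        moreover have "horizontal_speed k ?v \<le> \<rho> * (1 + C)"
        proof -
          have "\<bar>g (Suc k) s\<bar> \<le> C" using \<phi>C[of s] s C unfolding g_def by auto
          then have "\<bar>- (\<rho> * g (Suc k) s)\<bar> \<le> \<rho> * C" using \<rho> by (simp add: abs_mult)
          moreover have "\<bar>\<rho> * \<epsilon>\<bar> = \<rho>" using \<rho> by (simp add: \<epsilon>_def)
          moreover have "fst ?v = \<rho> * \<epsilon>" "snd ?v k = - (\<rho> * g (Suc k) s)" by (simp_all add: frame_comb_simps)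
          ultimately show ?thesis
            using horizontal_speed_le[of k ?v] by (simp add: distrib_left)
        qed
        ultimately show ?thesis using frame_comb_horizontal by blast
      qed
    qed (use \<rho> C in auto)
    moreover have "\<gamma> 0 = (t, u)"
    proof -
      have "T i 0 - \<rho> ^ (k + 1 - i) * g i 0 = u i" if "i \<le> k" for i
        using taylor_shift_zero[OF that, of v] \<phi>0[OF that] \<rho> by (simp add: T_def g_def \<omega>_def)
      then show ?thesis using uv0 by (auto simp: \<gamma>_def A_def fun_eq_iff)
    qed
    moreover have "\<gamma> 2 = (t, v)"
    proof -
      have "T i 0 = v i" if "i \<le> k" for i using taylor_shift_zero[OF that, of v] by (simp add: T_def)
      then show ?thesis using uv0 by (auto simp: \<gamma>_def A_def g_def fun_eq_iff)
    qed
    ultimately show "cc_dist k (t, u) (t, v) \<le> ennreal (2 * (1 + C) * \<rho>)" by (simp add: mult_ac)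
  qed
qed

section \<open>The jet curve and the hyperplane as weighted charts\<close>

lemma weighted_chart_jets:
  assumes "smooth_real f"
  shows "weighted_chart (cc_dist k) (\<lambda>u. jet_of k f (u 0)) {0} (\<lambda>_. 1)"
proof
  fix u v :: "nat \<Rightarrow> real" and \<rho> :: real and i :: nat
  assume "0 < \<rho>" "cc_dist k (jet_of k f (u 0)) (jet_of k f (v 0)) < ennreal \<rho>" "i \<in> {0}"
  then show "\<bar>u i - v i\<bar> \<le> \<rho> ^ 1"
    using cc_dist_fst_bound by (fastforce simp: jet_of_def)
next
  fix R :: real
  obtain C where C: "C > 0" "\<And>x y. \<bar>x\<bar> \<le> R \<Longrightarrow> \<bar>y\<bar> \<le> R \<Longrightarrow>
      cc_dist k (jet_of k f x) (jet_of k f y) \<le> ennreal (C * \<bar>x - y\<bar>)"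
    using cc_dist_jet_of_le[OF assms, of R k] by blast
  show "\<exists>C>0. \<forall>(u :: nat \<Rightarrow> real) (v :: nat \<Rightarrow> real) \<rho>. (\<forall>i\<in>{0}. \<bar>u i\<bar> \<le> R \<and> \<bar>v i\<bar> \<le> R) \<longrightarrow> 0 < \<rho> \<longrightarrow>
      (\<forall>i\<in>{0}. \<bar>u i - v i\<bar> \<le> \<rho> ^ 1) \<longrightarrow> cc_dist k (jet_of k f (u 0)) (jet_of k f (v 0)) \<le> ennreal (C * \<rho>)"
  proof (intro exI[of _ C] conjI allI impI C(1))
    fix u v :: "nat \<Rightarrow> real" and \<rho> :: real
    assume R: "\<forall>i\<in>{0}. \<bar>u i\<bar> \<le> R \<and> \<bar>v i\<bar> \<le> R" and uv: "\<forall>i\<in>{0}. \<bar>u i - v i\<bar> \<le> \<rho> ^ 1"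
    have "cc_dist k (jet_of k f (u 0)) (jet_of k f (v 0)) \<le> ennreal (C * \<bar>u 0 - v 0\<bar>)"
      using R by (intro C(2)) auto
    also have "\<dots> \<le> ennreal (C * \<rho>)"
      using C(1) uv by (intro ennreal_leI mult_left_mono) auto
    finally show "cc_dist k (jet_of k f (u 0)) (jet_of k f (v 0)) \<le> ennreal (C * \<rho>)" .
  qed
qed auto

definition vertical_point :: "nat \<Rightarrow> real \<Rightarrow> (nat \<Rightarrow> real) \<Rightarrow> jet" where
  "vertical_point k t u = (t, \<lambda>i. if i \<le> k then u i else 0)"

lemma weighted_chart_vertical:
  "weighted_chart (cc_dist k) (vertical_point k t) {..k} (\<lambda>i. k + 1 - i)"
proof
  fix u v :: "nat \<Rightarrow> real" and \<rho> :: real and i :: nat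
  assume "0 < \<rho>" and d: "cc_dist k (vertical_point k t u) (vertical_point k t v) < ennreal \<rho>" and "i \<in> {..k}"
  then show "\<bar>u i - v i\<bar> \<le> \<rho> ^ (k + 1 - i)"
    using cc_dist_vertical_bound[OF d, of i] by (simp add: vertical_point_def)
next
  fix R :: real
  obtain C where C: "C > 0" "\<And>t u v \<rho>. (\<forall>i>k. u i = 0 \<and> v i = 0) \<Longrightarrow> 0 < \<rho> \<Longrightarrow>
      (\<forall>i\<le>k. \<bar>u i - v i\<bar> \<le> \<rho> ^ (k + 1 - i)) \<Longrightarrow> cc_dist k (t, u) (t, v) \<le> ennreal (C * \<rho>)"
    using cc_dist_vertical_le[of k] by metis
  show "\<exists>C>0. \<forall>u v \<rho>. (\<forall>i\<in>{..k}. \<bar>u i\<bar> \<le> R \<and> \<bar>v i\<bar> \<le> R) \<longrightarrow> 0 < \<rho> \<longrightarrow>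
      (\<forall>i\<in>{..k}. \<bar>u i - v i\<bar> \<le> \<rho> ^ (k + 1 - i)) \<longrightarrow>
      cc_dist k (vertical_point k t u) (vertical_point k t v) \<le> ennreal (C * \<rho>)"
    unfolding vertical_point_def by (intro exI[of _ C] conjI allI impI C) auto
qed auto

lemma sum_weights: "(\<Sum>i\<le>k. k + 1 - i) * 2 = (k + 1) * (k + 2)" for k :: nat
  by (induction k) (simp_all add: sum.atMost_Suc_shift del: sum.atMost_Suc)

lemma range_vertical_point: "range (vertical_point k t) = {p \<in> jet_space k. fst p = t}"
proof
  show "range (vertical_point k t) \<subseteq> {p \<in> jet_space k. fst p = t}"
    by (auto simp: vertical_point_def jet_space_def)
  show "{p \<in> jet_space k. fst p = t} \<subseteq> range (vertical_point k t)"
  proof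
    fix p assume "p \<in> {p \<in> jet_space k. fst p = t}"
    then have "p = vertical_point k t (snd p)"
      by (auto simp: vertical_point_def jet_space_def prod_eq_iff fun_eq_iff)
    then show "p \<in> range (vertical_point k t)" by blast
  qed
qed

lemma vertical_map_in_jet_space:
  assumes "p \<in> jet_space k" shows "vertical_map k f t p \<in> jet_space k"
proof -
  interpret group "jet_group k" by (rule group_jet_group)
  have carrier: "carrier (jet_group k) = jet_space k" by (simp add: jet_group_def)
  show ?thesis
    unfolding vertical_map_def carrier[symmetric]
    by (intro m_closed inv_closed) (use assms jet_of_in_jet_space in \<open>simp_all add: carrier\<close>)
qed

text \<open>Hyperplane and jet curve are transversal factors of the group, with the two mappings as
projections.\<close>

lemma vertical_horizontal_coordinates:
  assumes "b \<in> jet_space k" "fst b = t" and p_def: "p = b \<otimes>\<^bsub>jet_group k\<^esub> jet_of k f x"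
  shows "p \<in> jet_space k" "vertical_map k f t p = b" "horizontal_map k f t p = jet_of k f x"
proof -
  interpret group "jet_group k" by (rule group_jet_group)
  have carrier: "carrier (jet_group k) = jet_space k" by (simp add: jet_group_def)
  have mem: "b \<in> carrier (jet_group k)" "jet_of k f x \<in> carrier (jet_group k)"
    using assms(1) jet_of_in_jet_space by (simp_all add: carrier)
  then show "p \<in> jet_space k" unfolding p_def carrier[symmetric] by (rule m_closed)
  have x: "fst p - t = x" using assms(2) by (simp add: p_def jet_group_def jet_mult_def jet_of_def)
  then show "horizontal_map k f t p = jet_of k f x" by (simp add: horizontal_map_def)
  show "vertical_map k f t p = b"
    unfolding vertical_map_def x unfolding p_def using mem by (simp add: m_assoc)
qed

theorem theorem4p12:
  fixes k :: nat and f :: "real \<Rightarrow> real" and t :: real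
  assumes "k \<ge> 1" and "smooth_real f"
  shows "(\<forall>E. E \<subseteq> jet_space k \<longrightarrow>
             0 \<le> dim_Hau k (horizontal_map k f t ` E) \<and>
             dim_Hau k (horizontal_map k f t ` E) \<le> 1 \<and>
             0 \<le> dim_Hau k (vertical_map k f t ` E) \<and>
             dim_Hau k (vertical_map k f t ` E) \<le> ereal (real ((k + 1) * (k + 2)) / 2)) \<and>
         (\<forall>\<alpha>\<in>{0..1::real}. \<forall>\<beta>\<in>{0..real ((k + 1) * (k + 2)) / 2}.
             \<exists>E. E \<subseteq> jet_space k \<and>
               dim_Hau k (horizontal_map k f t ` E) = ereal \<alpha> \<and>
               dim_Hau k (vertical_map k f t ` E) = ereal \<beta>)"
proof -
  interpret J: weighted_chart "cc_dist k" "\<lambda>u. jet_of k f (u 0)" "{0}" "\<lambda>_. 1"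
    using assms(2) by (rule weighted_chart_jets)
  interpret V: weighted_chart "cc_dist k" "vertical_point k t" "{..k}" "\<lambda>i. k + 1 - i"
    by (rule weighted_chart_vertical)
  have QJ: "real J.total_weight = 1" unfolding J.total_weight_def by simp
  have QV: "real V.total_weight = real ((k + 1) * (k + 2)) / 2"
    unfolding V.total_weight_def sum_weights[of k, symmetric] by simp
  show ?thesis
  proof (intro conjI allI impI ballI)
    fix E assume E: "E \<subseteq> jet_space k"
    have hE: "horizontal_map k f t ` E = (\<lambda>u. jet_of k f (u 0)) ` (\<lambda>p (_ :: nat). fst p - t) ` E"
      by (simp add: image_image horizontal_map_def)
    have "dim_Hau k (horizontal_map k f t ` E) \<le> ereal (real J.total_weight)"
      using J.dim_le unfolding hE .
    then show "dim_Hau k (horizontal_map k f t ` E) \<le> 1"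
      unfolding QJ by (simp add: one_ereal_def)
    have "vertical_map k f t ` E \<subseteq> range (vertical_point k t)"
      unfolding range_vertical_point using E vertical_map_in_jet_space fst_vertical_map by blast
    then have "dim_Hau k (vertical_map k f t ` E) \<le> dim_Hau k (range (vertical_point k t))"
      by (rule hausdorff_dim_mono)
    also have "\<dots> \<le> ereal (real V.total_weight)" by (rule V.dim_le)
    finally show "dim_Hau k (vertical_map k f t ` E) \<le> ereal (real ((k + 1) * (k + 2)) / 2)"
      unfolding QV .
  next
    fix \<alpha> \<beta> :: real assume \<alpha>: "\<alpha> \<in> {0..1}" and \<beta>: "\<beta> \<in> {0..real ((k + 1) * (k + 2)) / 2}"
    obtain X :: "(nat \<Rightarrow> real) set" where X: "X \<noteq> {}" "dim_Hau k ((\<lambda>u. jet_of k f (u 0)) ` X) = ereal \<alpha>"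
      using J.exists_set_of_dim[of \<alpha>] \<alpha> unfolding QJ by auto
    obtain Y where Y: "Y \<noteq> {}" "dim_Hau k (vertical_point k t ` Y) = ereal \<beta>"
      using V.exists_set_of_dim[of \<beta>] \<beta> unfolding QV by auto
    define P where "P = (\<lambda>(v, u :: nat \<Rightarrow> real). vertical_point k t v \<otimes>\<^bsub>jet_group k\<^esub> jet_of k f (u 0))"
    have b: "vertical_point k t v \<in> jet_space k" "fst (vertical_point k t v) = t" for v
      using range_vertical_point[of k t] by auto
    note coords = vertical_horizontal_coordinates[OF b refl]
    have "horizontal_map k f t ` P ` (Y \<times> X) = (\<lambda>u. jet_of k f (u 0)) ` snd ` (Y \<times> X)"
      unfolding P_def image_image by (intro image_cong refl) (simp add: coords split_beta)
    also have "snd ` (Y \<times> X) = X" using Y(1) by simp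
    finally have H: "dim_Hau k (horizontal_map k f t ` P ` (Y \<times> X)) = ereal \<alpha>" using X(2) by simp
    have "vertical_map k f t ` P ` (Y \<times> X) = vertical_point k t ` fst ` (Y \<times> X)"
      unfolding P_def image_image by (intro image_cong refl) (simp add: coords split_beta)
    also have "fst ` (Y \<times> X) = Y" using X(1) by simp
    finally have V: "dim_Hau k (vertical_map k f t ` P ` (Y \<times> X)) = ereal \<beta>" using Y(2) by simp
    have "P ` (Y \<times> X) \<subseteq> jet_space k" using coords(1) by (auto simp: P_def)
    with H V show "\<exists>E. E \<subseteq> jet_space k \<and> dim_Hau k (horizontal_map k f t ` E) = ereal \<alpha> \<and>
        dim_Hau k (vertical_map k f t ` E) = ereal \<beta>" by blast
  qed (rule hausdorff_dim_nonneg)+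
qed

end
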